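(* Let $M$ be a smooth manifold of dimension $n$ and let $\mathcal{J}\colon\mathbb{T}M\to\mathbb{T}M$ be a weak generalized almost complex structure, written in matrix form as $\mathcal{J}(X+\xi)=(AX+B\xi)+(CX+D\xi)$ with bundle morphisms $A\colon TM\to TM$, $B\colon T^*M\to TM$, $C\colon TM\to T^*M$, $D\colon T^*M\to T^*M$. Let $(U,(x^1,\dots,x^n))$ be local coordinates on $M$, and write $$A\partial_i=A_i^j\partial_j,\quad B\,dx^i=B^{ij}\partial_j,\quad C\partial_i=C_{ij}dx^j,\quad D\,dx^i=D^i_jdx^j .$$ If $\mathcal{J}$ is integrable, then for all $i,j,l=1,\dots,n$ the following hold on $U$ (summation over the repeated index $k$): $$A^k_i\frac{\partial A^l_j}{\partial x^k}-A^k_j\frac{\partial A^l_i}{\partial x^k}+A^l_k\left(\frac{\partial A^k_i}{\partial x^j}-\frac{\partial A^k_j}{\partial x^i}\right)-B^{kl}\left(\frac{\partial C_{jk}}{\partial x^i}-\frac{\partial C_{ik}}{\partial x^j}+\frac{\partial C_{ij}}{\partial x^k}\right)=0,$$ $$A^k_i\frac{\partial C_{jl}}{\partial x^k}+C_{jk}\frac{\partial A^k_i}{\partial x^l}+A^k_j\left(\frac{\partial C_{ik}}{\partial x^l}-\frac{\partial C_{il}}{\partial x^k}\right)+C_{kl}\left(\frac{\partial A^k_i}{\partial x^j}-\frac{\partial A^k_j}{\partial x^i}\right)-D^k_l\left(\frac{\partial C_{jk}}{\partial x^i}-\frac{\partial C_{ik}}{\partial x^j}+\frac{\partial C_{ij}}{\partial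 x^k}\right)=0,$$ $$A^k_i\frac{\partial B^{jl}}{\partial x^k}-B^{jk}\frac{\partial A^l_i}{\partial x^k}-A^l_k\frac{\partial B^{jk}}{\partial x^i}-B^{kl}\left(\frac{\partial A^j_i}{\partial x^k}+\frac{\partial D^j_k}{\partial x^i}\right)=0,$$ $$A^k_i\frac{\partial D^j_l}{\partial x^k}+D^j_k\frac{\partial A^k_i}{\partial x^l}+B^{jk}\left(\frac{\partial C_{ik}}{\partial x^l}-\frac{\partial C_{il}}{\partial x^k}\right)-C_{kl}\frac{\partial B^{jk}}{\partial x^i}-D^k_l\left(\frac{\partial A^j_i}{\partial x^k}+\frac{\partial D^j_k}{\partial x^i}\right)=0,$$ $$B^{ik}\frac{\partial A^l_j}{\partial x^k}-A^k_j\frac{\partial B^{il}}{\partial x^k}+A^l_k\frac{\partial B^{ik}}{\partial x^j}+B^{kl}\left(\frac{\partial D^i_k}{\partial x^j}-\frac{\partial D^i_j}{\partial x^k}\right)=0,$$ $$B^{ik}\frac{\partial C_{jl}}{\partial x^k}+C_{jk}\frac{\partial B^{ik}}{\partial x^l}+A^k_j\left(\frac{\partial D^i_k}{\partial x^l}-\frac{\partial D^i_l}{\partial x^k}\right)+C_{kl}\frac{\partial B^{ik}}{\partial x^j}+D^k_l\left(\frac{\partial D^i_k}{\partial x^j}-\frac{\partial D^i_j}{\partial x^k}\right)=0,$$ $$B^{ik}\frac{\partial B^{jl}}{\partial x^k}-B^{jk}\frac{\partial B^{il}}{\partial x^k}-B^{kl}\frac{\partial B^{ij}}{\partial x^k}=0,$$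 $$B^{ik}\frac{\partial D^j_l}{\partial x^k}+D^j_k\frac{\partial B^{ik}}{\partial x^l}+B^{jk}\left(\frac{\partial D^i_k}{\partial x^l}-\frac{\partial D^i_l}{\partial x^k}\right)-D^k_l\frac{\partial B^{ij}}{\partial x^k}=0.$$
   Context: All manifolds, functions and tensor fields are smooth. For a manifold $M$, $\mathbb{T}M:=TM\oplus T^*M$ is the generalized tangent bundle; its sections are sums $X+\xi$ of a vector field $X$ and a 1-form $\xi$. A weak generalized almost complex structure is a bundle endomorphism $\mathcal{J}\colon\mathbb{T}M\to\mathbb{T}M$ (over the identity of $M$) with $\mathcal{J}^2=-\mathrm{Id}$. The Dorfman bracket is $[\![X+\xi,Y+\eta]\!]=[X,Y]+\mathcal{L}_X\eta-i_Yd\xi$, extended $\mathbb{C}$-bilinearly to sections of $\mathbb{T}M\otimes\mathbb{C}$. A weak generalized almost complex structure $\mathcal{J}$ is integrable if the subbundle $\mathbb{L}^{1,0}_{\mathcal{J}}=\{u-i\mathcal{J}u: u\in\mathbb{T}M\}\subset\mathbb{T}M\otimes\mathbb{C}$ is involutive, i.e. $[\![u-i\mathcal{J}u,v-i\mathcal{J}v]\!]\in\Gamma(\mathbb{L}^{1,0}_{\mathcal{J}})$ for all $u,v\in\Gamma(\mathbb{T}M)$. Einstein summation convention is used in local coordinates, and $\partial_i=\partial/\partial x^i$. *)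

theory Defs
  imports "HOL-Analysis.Analysis" "HOL-Library.Function_Algebras"
begin

text \<open>Tangent and cotangent vectors are real functionals, so the pointwise real vector space
  structure on functions is used throughout (and, via products, on pairs \<open>X + \<xi>\<close>).\<close>

instantiation "fun" :: (type, real_vector) real_vector
begin

definition scaleR_fun :: "real \<Rightarrow> ('a \<Rightarrow> 'b) \<Rightarrow> 'a \<Rightarrow> 'b" where
  "scaleR_fun r f = (\<lambda>x. r *\<^sub>R f x)"

instance
  by standard (simp_all add: scaleR_fun_def plus_fun_def fun_eq_iff algebra_simps)

end

section \<open>Smooth manifolds\<close>

text \<open>For open sets in Euclidean space: all iterated directional derivatives exist and are
  continuous.\<close>

primrec Ck_on :: "nat \<Rightarrow> 'a::real_normed_vector set \<Rightarrow> ('a \<Rightarrow> 'b::real_normed_vector) \<Rightarrow> bool" where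
  "Ck_on 0 S f \<longleftrightarrow> continuous_on S f"
| "Ck_on (Suc k) S f \<longleftrightarrow>
     (\<forall>x\<in>S. f differentiable (at x)) \<and>
     (\<forall>v. Ck_on k S (\<lambda>x. frechet_derivative f (at x) v))"

definition smooth_on :: "'a::real_normed_vector set \<Rightarrow> ('a \<Rightarrow> 'b::real_normed_vector) \<Rightarrow> bool" where
  "smooth_on S f \<longleftrightarrow> (\<forall>k. Ck_on k S f)"

text \<open>A chart is a pair \<open>(U, x)\<close>; the values of \<open>x\<close> outside \<open>U\<close> are irrelevant.\<close>

type_synonym ('m, 'n) chart = "'m set \<times> ('m \<Rightarrow> real ^ 'n)"

definition chart_inv :: "('m, 'n) chart \<Rightarrow> real ^ 'n \<Rightarrow> 'm" where
  "chart_inv c = inv_into (fst c) (snd c)"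

definition is_chart :: "('m::topological_space, 'n::finite) chart \<Rightarrow> bool" where
  "is_chart c \<longleftrightarrow> open (fst c) \<and> open (snd c ` fst c) \<and>
     homeomorphism (fst c) (snd c ` fst c) (snd c) (chart_inv c)"

definition compatible :: "('m, 'n::finite) chart \<Rightarrow> ('m, 'n) chart \<Rightarrow> bool" where
  "compatible c c' \<longleftrightarrow>
     smooth_on (snd c ` (fst c \<inter> fst c')) (snd c' \<circ> chart_inv c) \<and>
     smooth_on (snd c' ` (fst c \<inter> fst c')) (snd c \<circ> chart_inv c')"

text \<open>The manifold is the whole type \<open>'m\<close> (Hausdorff and second countable), its dimension is
  \<open>CARD('n)\<close>, and its smooth structure is a maximal smooth atlas.\<close>

definition smooth_structure ::
    "('m::{t2_space, second_countable_topology}, 'n::finite) chart set \<Rightarrow> bool" where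
  "smooth_structure \<A> \<longleftrightarrow>
     (\<forall>c\<in>\<A>. is_chart c) \<and>
     (\<Union>c\<in>\<A>. fst c) = UNIV \<and>
     (\<forall>c\<in>\<A>. \<forall>c'\<in>\<A>. compatible c c') \<and>
     (\<forall>c. is_chart c \<and> (\<forall>c'\<in>\<A>. compatible c c') \<longrightarrow> c \<in> \<A>)"

definition smooth_functions :: "('m, 'n::finite) chart set \<Rightarrow> ('m \<Rightarrow> real) set" where
  "smooth_functions \<A> = {f. \<forall>c\<in>\<A>. smooth_on (snd c ` fst c) (f \<circ> chart_inv c)}"

text \<open>\<open>partial (U, x) i f p\<close> is \<open>(\<partial>f / \<partial>x\<^sup>i)(p)\<close>; it makes sense for \<open>p \<in> U\<close> and only depends on
  \<open>f\<close> on \<open>U\<close>.\<close>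

definition partial :: "('m, 'n::finite) chart \<Rightarrow> 'n \<Rightarrow> ('m \<Rightarrow> real) \<Rightarrow> 'm \<Rightarrow> real" where
  "partial c i f p = frechet_derivative (f \<circ> chart_inv c) (at (snd c p)) (axis i 1)"

section \<open>Tangent and cotangent vectors\<close>

text \<open>Tangent vectors at \<open>p\<close> are derivations at \<open>p\<close> of the algebra of smooth functions on the
  manifold, and covectors are linear functionals on the tangent space. Both are extended by zero
  outside their domain, so that equality of vectors and covectors is equality in HOL.\<close>

type_synonym 'm tvec = "('m \<Rightarrow> real) \<Rightarrow> real"
type_synonym 'm covec = "'m tvec \<Rightarrow> real"
type_synonym 'm gvec = "'m tvec \<times> 'm covec"

definition tangent_space :: "('m, 'n::finite) chart set \<Rightarrow> 'm \<Rightarrow> 'm tvec set" where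
  "tangent_space \<A> p = {v.
     (\<forall>f\<in>smooth_functions \<A>. \<forall>g\<in>smooth_functions \<A>.
        v (\<lambda>q. f q + g q) = v f + v g \<and>
        v (\<lambda>q. f q * g q) = v f * g p + f p * v g) \<and>
     (\<forall>r. \<forall>f\<in>smooth_functions \<A>. v (\<lambda>q. r * f q) = r * v f) \<and>
     (\<forall>f. f \<notin> smooth_functions \<A> \<longrightarrow> v f = 0)}"

definition cotangent_space :: "('m, 'n::finite) chart set \<Rightarrow> 'm \<Rightarrow> 'm covec set" where
  "cotangent_space \<A> p = {\<omega>.
     (\<forall>v\<in>tangent_space \<A> p. \<forall>w\<in>tangent_space \<A> p. \<omega> (v + w) = \<omega> v + \<omega> w) \<and>
     (\<forall>r. \<forall>v\<in>tangent_space \<A> p. \<omega> (r *\<^sub>R v) = r * \<omega> v) \<and>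
     (\<forall>v. v \<notin> tangent_space \<A> p \<longrightarrow> \<omega> v = 0)}"

definition vector_fields :: "('m, 'n::finite) chart set \<Rightarrow> ('m \<Rightarrow> 'm tvec) set" where
  "vector_fields \<A> = {X. (\<forall>p. X p \<in> tangent_space \<A> p) \<and>
     (\<forall>f\<in>smooth_functions \<A>. (\<lambda>p. X p f) \<in> smooth_functions \<A>)}"

definition one_forms :: "('m, 'n::finite) chart set \<Rightarrow> ('m \<Rightarrow> 'm covec) set" where
  "one_forms \<A> = {\<xi>. (\<forall>p. \<xi> p \<in> cotangent_space \<A> p) \<and>
     (\<forall>X\<in>vector_fields \<A>. (\<lambda>p. \<xi> p (X p)) \<in> smooth_functions \<A>)}"

definition coord_vec :: "('m, 'n::finite) chart set \<Rightarrow> ('m, 'n) chart \<Rightarrow> 'n \<Rightarrow> 'm \<Rightarrow> 'm tvec" where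
  "coord_vec \<A> c i p = (\<lambda>f. if f \<in> smooth_functions \<A> then partial c i f p else 0)"

text \<open>The differential at \<open>p\<close> of a function \<open>h\<close> that is smooth near \<open>p\<close> sends \<open>v\<close> to \<open>v h\<close>. As
  tangent vectors act on globally smooth functions, \<open>h\<close> is replaced by any globally smooth function
  with the same germ at \<open>p\<close>; derivations do not see the choice.\<close>

definition differential ::
    "('m::topological_space, 'n::finite) chart set \<Rightarrow> ('m \<Rightarrow> real) \<Rightarrow> 'm \<Rightarrow> 'm covec" where
  "differential \<A> h p = (\<lambda>v. if v \<in> tangent_space \<A> p
     then v (SOME g. g \<in> smooth_functions \<A> \<and> (\<exists>V. open V \<and> p \<in> V \<and> (\<forall>q\<in>V. g q = h q)))
     else 0)"

definition coord_form ::
    "('m::topological_space, 'n::finite) chart set \<Rightarrow> ('m, 'n) chart \<Rightarrow> 'n \<Rightarrow> 'm \<Rightarrow> 'm covec" where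
  "coord_form \<A> c i = differential \<A> (\<lambda>q. snd c q $ i)"

section \<open>Vector bundles and their morphisms\<close>

text \<open>A bundle is given by its fibres and its space of global smooth sections. A fibrewise linear
  map is a (smooth) bundle morphism iff it takes smooth sections to smooth sections.\<close>

record ('m, 'v) vbundle =
  fib :: "'m \<Rightarrow> 'v set"
  sec :: "('m \<Rightarrow> 'v) set"

definition bundle_morphism ::
    "('m, 'v::real_vector) vbundle \<Rightarrow> ('m, 'w::real_vector) vbundle \<Rightarrow> ('m \<Rightarrow> 'v \<Rightarrow> 'w) \<Rightarrow> bool" where
  "bundle_morphism E F \<Phi> \<longleftrightarrow>
     (\<forall>p. \<forall>a\<in>fib E p. \<Phi> p a \<in> fib F p) \<and>
     (\<forall>p. \<forall>a\<in>fib E p. \<forall>b\<in>fib E p. \<Phi> p (a + b) = \<Phi> p a + \<Phi> p b) \<and>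
     (\<forall>p r. \<forall>a\<in>fib E p. \<Phi> p (r *\<^sub>R a) = r *\<^sub>R \<Phi> p a) \<and>
     (\<forall>s\<in>sec E. (\<lambda>p. \<Phi> p (s p)) \<in> sec F)"

definition tangent_bundle :: "('m, 'n::finite) chart set \<Rightarrow> ('m, 'm tvec) vbundle" where
  "tangent_bundle \<A> = \<lparr>fib = tangent_space \<A>, sec = vector_fields \<A>\<rparr>"

definition cotangent_bundle :: "('m, 'n::finite) chart set \<Rightarrow> ('m, 'm covec) vbundle" where
  "cotangent_bundle \<A> = \<lparr>fib = cotangent_space \<A>, sec = one_forms \<A>\<rparr>"

definition direct_sum :: "('m, 'v) vbundle \<Rightarrow> ('m, 'w) vbundle \<Rightarrow> ('m, 'v \<times> 'w) vbundle" where
  "direct_sum E F = \<lparr>fib = (\<lambda>p. fib E p \<times> fib F p),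
     sec = {s. (\<lambda>p. fst (s p)) \<in> sec E \<and> (\<lambda>p. snd (s p)) \<in> sec F}\<rparr>"

definition gen_tangent_bundle :: "('m, 'n::finite) chart set \<Rightarrow> ('m, 'm gvec) vbundle" where
  "gen_tangent_bundle \<A> = direct_sum (tangent_bundle \<A>) (cotangent_bundle \<A>)"

text \<open>\<open>E \<otimes> \<complex> = E \<oplus> iE\<close>: the pair \<open>(a, b)\<close> stands for \<open>a + i b\<close>.\<close>

definition complexification :: "('m, 'v) vbundle \<Rightarrow> ('m, 'v \<times> 'v) vbundle" where
  "complexification E = direct_sum E E"

section \<open>The Dorfman bracket\<close>

definition lie_bracket :: "('m \<Rightarrow> 'm tvec) \<Rightarrow> ('m \<Rightarrow> 'm tvec) \<Rightarrow> 'm \<Rightarrow> 'm tvec" where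
  "lie_bracket X Y p = (\<lambda>f. X p (\<lambda>q. Y q f) - Y p (\<lambda>q. X q f))"

text \<open>The invariant formulas
  \<open>(L\<^sub>X \<eta>)(Z) = X(\<eta>(Z)) - \<eta>([X,Z])\<close> and \<open>d\<xi>(V,W) = V(\<xi>(W)) - W(\<xi>(V)) - \<xi>([V,W])\<close>
  are tensorial in \<open>Z\<close>, respectively in \<open>V\<close> and \<open>W\<close>. Their values on tangent vectors at \<open>p\<close> are
  obtained by inserting arbitrary vector fields extending these tangent vectors.\<close>

definition extend_vec :: "('m, 'n::finite) chart set \<Rightarrow> 'm \<Rightarrow> 'm tvec \<Rightarrow> 'm \<Rightarrow> 'm tvec" where
  "extend_vec \<A> p v = (SOME Z. Z \<in> vector_fields \<A> \<and> Z p = v)"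

definition lie_deriv_form ::
    "('m, 'n::finite) chart set \<Rightarrow> ('m \<Rightarrow> 'm tvec) \<Rightarrow> ('m \<Rightarrow> 'm covec) \<Rightarrow> 'm \<Rightarrow> 'm covec" where
  "lie_deriv_form \<A> X \<eta> p = (\<lambda>v. if v \<in> tangent_space \<A> p
     then let Z = extend_vec \<A> p v in X p (\<lambda>q. \<eta> q (Z q)) - \<eta> p (lie_bracket X Z p)
     else 0)"

definition ext_deriv ::
    "('m, 'n::finite) chart set \<Rightarrow> ('m \<Rightarrow> 'm covec) \<Rightarrow> 'm \<Rightarrow> 'm tvec \<Rightarrow> 'm tvec \<Rightarrow> real" where
  "ext_deriv \<A> \<xi> p v w = (if v \<in> tangent_space \<A> p \<and> w \<in> tangent_space \<A> p
     then let V = extend_vec \<A> p v; W = extend_vec \<A> p w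
          in v (\<lambda>q. \<xi> q (W q)) - w (\<lambda>q. \<xi> q (V q)) - \<xi> p (lie_bracket V W p)
     else 0)"

definition interior_prod ::
    "('m \<Rightarrow> 'm tvec) \<Rightarrow> ('m \<Rightarrow> 'm tvec \<Rightarrow> 'm tvec \<Rightarrow> real) \<Rightarrow> 'm \<Rightarrow> 'm covec" where
  "interior_prod Y \<omega> p = (\<lambda>w. \<omega> p (Y p) w)"

definition dorfman ::
    "('m, 'n::finite) chart set \<Rightarrow> ('m \<Rightarrow> 'm gvec) \<Rightarrow> ('m \<Rightarrow> 'm gvec) \<Rightarrow> 'm \<Rightarrow> 'm gvec" where
  "dorfman \<A> u v =
     (let X = (\<lambda>p. fst (u p)); \<xi> = (\<lambda>p. snd (u p));
          Y = (\<lambda>p. fst (v p)); \<eta> = (\<lambda>p. snd (v p))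
      in (\<lambda>p. (lie_bracket X Y p, lie_deriv_form \<A> X \<eta> p - interior_prod Y (ext_deriv \<A> \<xi>) p)))"

definition dorfman_complex ::
    "('m, 'n::finite) chart set \<Rightarrow> ('m \<Rightarrow> 'm gvec \<times> 'm gvec) \<Rightarrow> ('m \<Rightarrow> 'm gvec \<times> 'm gvec) \<Rightarrow>
     'm \<Rightarrow> 'm gvec \<times> 'm gvec" where
  "dorfman_complex \<A> w z =
     (let a = (\<lambda>p. fst (w p)); b = (\<lambda>p. snd (w p));
          c = (\<lambda>p. fst (z p)); d = (\<lambda>p. snd (z p))
      in (\<lambda>p. (dorfman \<A> a c p - dorfman \<A> b d p, dorfman \<A> a d p + dorfman \<A> b c p)))"

section \<open>Weak generalized complex structures\<close>

definition weak_gen_almost_complex ::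
    "('m, 'n::finite) chart set \<Rightarrow> ('m \<Rightarrow> 'm gvec \<Rightarrow> 'm gvec) \<Rightarrow> bool" where
  "weak_gen_almost_complex \<A> \<J> \<longleftrightarrow>
     bundle_morphism (gen_tangent_bundle \<A>) (gen_tangent_bundle \<A>) \<J> \<and>
     (\<forall>p. \<forall>u\<in>fib (gen_tangent_bundle \<A>) p. \<J> p (\<J> p u) = - u)"

text \<open>\<open>u - i \<J> u\<close>, with complex vectors encoded as pairs.\<close>

definition minus_i :: "('m \<Rightarrow> 'm gvec \<Rightarrow> 'm gvec) \<Rightarrow> 'm \<Rightarrow> 'm gvec \<Rightarrow> 'm gvec \<times> 'm gvec" where
  "minus_i \<J> p u = (u, - \<J> p u)"

definition L10 ::
    "('m, 'n::finite) chart set \<Rightarrow> ('m \<Rightarrow> 'm gvec \<Rightarrow> 'm gvec) \<Rightarrow> ('m, 'm gvec \<times> 'm gvec) vbundle" where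
  "L10 \<A> \<J> = (let F = (\<lambda>p. minus_i \<J> p ` fib (gen_tangent_bundle \<A>) p)
     in \<lparr>fib = F, sec = {w \<in> sec (complexification (gen_tangent_bundle \<A>)). \<forall>p. w p \<in> F p}\<rparr>)"

definition integrable_gen ::
    "('m, 'n::finite) chart set \<Rightarrow> ('m \<Rightarrow> 'm gvec \<Rightarrow> 'm gvec) \<Rightarrow> bool" where
  "integrable_gen \<A> \<J> \<longleftrightarrow>
     (\<forall>u\<in>sec (gen_tangent_bundle \<A>). \<forall>v\<in>sec (gen_tangent_bundle \<A>).
        dorfman_complex \<A> (\<lambda>p. minus_i \<J> p (u p)) (\<lambda>p. minus_i \<J> p (v p)) \<in> sec (L10 \<A> \<J>))"

end

theory Submission
  imports Defs
begin

text \<open>Write \<open>S = [\<J>u, w] + [u, \<J>w]\<close> for the Dorfman bracket. Comparing real and imaginary parts of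
  \<open>[u - i\<J>u, w - i\<J>w]\<close>, involutivity says \<open>\<J> S = [\<J>u, \<J>w] - [u, w]\<close>. The eight identities are the
  vector and covector components of this equation for \<open>u\<close> and \<open>w\<close> among the coordinate fields
  \<open>\<partial>\<^sub>i\<close> and \<open>dx\<^sup>i\<close>, whose mutual brackets vanish. As all objects are global, the coordinate fields are
  first cut off by a bump function. Hadamard's lemma shows that a derivation at \<open>p\<close> is
  determined by its values on the coordinate functions, which yields the coordinate
  formulas for the bracket.\<close>

section \<open>Calculus of smooth functions\<close>

text \<open>Working near a point is legitimate because the identities at \<open>p\<close> involve
  only values and first derivatives at \<open>p\<close>: it is enough that global functions
  \<open>g k\<close>, fields \<open>E k\<close> and forms \<open>G k\<close> agree with the
  coordinate ones on an open \<open>V\<close> around \<open>p\<close>. Components of a section are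
  read off by pairing with \<open>g k\<close> and \<open>E k\<close>. Two difficulties shape the
  argument. The Lie derivative and the exterior derivative are defined through an arbitrarily chosen
  extension of a tangent vector, about which only the value at one point is known; in coordinates
  the derivatives of the extension cancel. And the matrix entries \<open>a\<close>,
  \<open>b\<close>, \<open>c\<close>, \<open>d\<close> are bare functions: they inherit smoothness
  on \<open>V\<close> from the sections \<open>\<J> (E i)\<close> and \<open>\<J> (G i)\<close>,
  whose components they are. Extending local functions by zero relies on compact sets being closed,
  which is where the Hausdorff property enters.\<close>

lemma frechet_derivative_cong_open:
  assumes "open S" "x \<in> S" "\<And>y. y \<in> S \<Longrightarrow> f y = g y"
  shows "frechet_derivative f (at x) = frechet_derivative g (at x)"
proof -
  \<comment> \<open>\<open>frechet_derivative\<close> is a choice among derivatives, so equality is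
    obtained from equivalence of the two predicates, whether or not a derivative exists.\<close>
  have "(f has_derivative D) (at x) \<longleftrightarrow> (g has_derivative D) (at x)" for D
    using has_derivative_transform_within_open[OF _ assms(1,2), of f D UNIV g]
      has_derivative_transform_within_open[OF _ assms(1,2), of g D UNIV f] assms(3) by auto
  then show ?thesis unfolding frechet_derivative_def by simp
qed

lemma differentiable_cong_open:
  assumes "open S" "x \<in> S" "\<And>y. y \<in> S \<Longrightarrow> f y = g y" "f differentiable (at x)"
  shows "g differentiable (at x)"
  using assms has_derivative_transform_within_open[OF _ assms(1,2), of f _ UNIV g]
  unfolding differentiable_def by blast

section \<open>Locality and closure properties of C^k functions\<close>

lemma Ck_on_cong_imp:
  assumes "open S" "\<And>y. y \<in> S \<Longrightarrow> f y = g y" "Ck_on k S f"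
  shows "Ck_on k S g"
  using assms(2,3)
proof (induction k arbitrary: f g)
  case 0 then show ?case using continuous_on_cong[of S S f g] by auto
next
  case (Suc k)
  have "frechet_derivative f (at x) v = frechet_derivative g (at x) v" if "x \<in> S" for x v
    using frechet_derivative_cong_open[OF assms(1) that, of f g] Suc.prems by auto
  then have "Ck_on k S (\<lambda>x. frechet_derivative g (at x) v)" for v
    using Suc.IH[of "\<lambda>x. frechet_derivative f (at x) v"] Suc.prems by auto
  then show ?case using Suc.prems differentiable_cong_open[OF assms(1), of _ f g] by auto
qed

lemma Ck_on_Suc_imp: "Ck_on (Suc k) S f \<Longrightarrow> Ck_on k S f"
proof (induction k arbitrary: f)
  case 0 then show ?case
    by (auto intro!: continuous_at_imp_continuous_on differentiable_imp_continuous_within)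
qed auto

text \<open>The definition refers to the chosen \<open>frechet_derivative\<close>; this rule accepts
  any explicit derivative formula \<open>D\<close>. The two agree on \<open>S\<close>, and openness
  lets this agreement pass to all further derivatives.\<close>

lemma Ck_on_SucI:
  assumes "open S" "\<And>x. x \<in> S \<Longrightarrow> (f has_derivative D x) (at x)"
    and "\<And>v. Ck_on k S (\<lambda>x. D x v)"
  shows "Ck_on (Suc k) S f"
proof -
  have "D x v = frechet_derivative f (at x) v" if "x \<in> S" for x v
    using frechet_derivative_at[OF assms(2)[OF that]] by simp
  then have "Ck_on k S (\<lambda>x. frechet_derivative f (at x) v)" for v
    using Ck_on_cong_imp[OF assms(1) _ assms(3)] by auto
  then show ?thesis using assms(2) by (auto simp: differentiable_def)
qed

lemma Ck_on_SucD:
  assumes "Ck_on (Suc k) S f" "x \<in> S"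
  shows "(f has_derivative frechet_derivative f (at x)) (at x)"
  using assms by (simp add: frechet_derivative_works[symmetric])

lemma Ck_on_frechet_derivative:
  "Ck_on (Suc k) S f \<Longrightarrow> Ck_on k S (\<lambda>x. frechet_derivative f (at x) v)"
  by simp

lemma Ck_on_subset: "Ck_on k S f \<Longrightarrow> T \<subseteq> S \<Longrightarrow> Ck_on k T f"
  by (induction k arbitrary: f) (auto intro: continuous_on_subset)

text \<open>Needed for functions given by different formulas on different open sets, such as
  extensions by zero.\<close>

lemma Ck_on_local:
  assumes "\<And>x. x \<in> S \<Longrightarrow> \<exists>T. open T \<and> x \<in> T \<and> Ck_on k T f"
  shows "Ck_on k S f"
  using assms
proof (induction k arbitrary: f)
  case 0
  have "continuous (at x) f" if "x \<in> S" for x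
    using 0[OF that] by (auto simp: continuous_on_eq_continuous_at)
  then show ?case by (simp add: continuous_at_imp_continuous_on)
next
  case (Suc k)
  have "Ck_on k S (\<lambda>x. frechet_derivative f (at x) v)" for v
    using Suc.IH[of "\<lambda>x. frechet_derivative f (at x) v"] Suc.prems by fastforce
  then show ?case using Suc.prems by fastforce
qed

lemma Ck_on_const: "open S \<Longrightarrow> Ck_on k S (\<lambda>x. c)"
  by (induction k arbitrary: c) (auto intro: Ck_on_SucI[OF _ has_derivative_const] simp del: Ck_on.simps(2))

lemma Ck_on_linear:
  assumes "open S" "bounded_linear f"
  shows "Ck_on k S f"
proof (cases k)
  case 0 then show ?thesis using assms by (simp add: linear_continuous_on)
next
  case (Suc k')
  then show ?thesis
    using Ck_on_SucI[OF assms(1) bounded_linear_imp_has_derivative[OF assms(2)] Ck_on_const[OF assms(1)]]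
    by simp
qed

lemma Ck_on_add:
  assumes "open S" "Ck_on k S f" "Ck_on k S g"
  shows "Ck_on k S (\<lambda>x. f x + g x)"
  using assms(2,3)
proof (induction k arbitrary: f g)
  case 0 then show ?case by (auto intro: continuous_intros)
next
  case (Suc k)
  show ?case
    by (rule Ck_on_SucI[OF assms(1) has_derivative_add[OF Ck_on_SucD[OF Suc.prems(1)] Ck_on_SucD[OF Suc.prems(2)]]])
      (use Suc in auto)
qed

lemma Ck_on_sum:
  assumes "open S" "\<And>i. i \<in> I \<Longrightarrow> Ck_on k S (f i)"
  shows "Ck_on k S (\<lambda>x. \<Sum>i\<in>I. f i x)"
  using assms(2)
proof (induction I rule: infinite_finite_induct)
  case (insert i I)
  then show ?case using Ck_on_add[OF assms(1), of k "f i" "\<lambda>x. \<Sum>i\<in>I. f i x"] by simp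
qed (simp_all add: Ck_on_const assms(1))

lemma Ck_on_mult:
  fixes f g :: "'a::real_normed_vector \<Rightarrow> real"
  assumes "open S" "Ck_on k S f" "Ck_on k S g"
  shows "Ck_on k S (\<lambda>x. f x * g x)"
  using assms(2,3)
proof (induction k arbitrary: f g)
  case 0 then show ?case by (auto intro: continuous_intros)
next
  case (Suc k)
  have 1: "Ck_on k S (\<lambda>x. f x * frechet_derivative g (at x) v)" for v
    using Suc.IH[OF Ck_on_Suc_imp[OF Suc.prems(1)]] Suc.prems(2) by auto
  have 2: "Ck_on k S (\<lambda>x. frechet_derivative f (at x) v * g x)" for v
    using Suc.IH[OF _ Ck_on_Suc_imp[OF Suc.prems(2)]] Suc.prems(1) by auto
  show ?case
    by (rule Ck_on_SucI[OF assms(1) has_derivative_mult[OF Ck_on_SucD[OF Suc.prems(1)] Ck_on_SucD[OF Suc.prems(2)]]])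
      (use 1 2 in \<open>auto intro!: Ck_on_add assms(1)\<close>)
qed

lemma Ck_on_component:
  fixes f :: "'a::real_normed_vector \<Rightarrow> real ^ 'n::finite"
  assumes "open S" "Ck_on k S f"
  shows "Ck_on k S (\<lambda>x. f x $ i)"
  using assms(2)
proof (induction k arbitrary: f)
  case 0 then show ?case by (auto intro: continuous_intros)
next
  case (Suc k)
  show ?case
    by (rule Ck_on_SucI[OF assms(1) bounded_linear.has_derivative[OF bounded_linear_vec_nth Ck_on_SucD[OF Suc.prems(1)]]])
      (use Suc in auto)
qed

lemma linear_axis_expansion:
  fixes L :: "real ^ 'n::finite \<Rightarrow> real"
  assumes "linear L"
  shows "L v = (\<Sum>k\<in>UNIV. v $ k * L (axis k 1))"
proof -
  have "L v = L (\<Sum>k\<in>UNIV. v $ k *\<^sub>R axis k 1)"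
    using basis_expansion[of v] by (simp add: scalar_mult_eq_scaleR)
  then show ?thesis by (simp add: linear_sum[OF assms] linear_cmul[OF assms])
qed

text \<open>\<open>Ck_on\<close> differentiates only in fixed directions, whereas the chain rule
  applies the derivative of \<open>f\<close> to a vector that moves with \<open>x\<close>. Expanding
  this vector along the axes leaves a sum of products, to which the induction hypothesis applies
  factor by factor.\<close>

lemma Ck_on_compose:
  fixes f :: "real ^ 'n::finite \<Rightarrow> real" and g :: "'a::real_normed_vector \<Rightarrow> real ^ 'n"
  assumes "open S" "open T" "g ` S \<subseteq> T" "Ck_on k S g" "Ck_on k T f"
  shows "Ck_on k S (\<lambda>x. f (g x))"
  using assms(4,5)
proof (induction k arbitrary: f)
  case 0 then show ?case
    using continuous_on_compose2[of T f S g] assms(3) by auto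
next
  case (Suc k)
  have D: "((\<lambda>x. f (g x)) has_derivative
      (\<lambda>v. \<Sum>i\<in>UNIV. frechet_derivative g (at x) v $ i * frechet_derivative f (at (g x)) (axis i 1))) (at x)"
    if "x \<in> S" for x
  proof -
    have fD: "(f has_derivative frechet_derivative f (at (g x))) (at (g x))"
      using that assms(3) by (intro Ck_on_SucD[OF Suc.prems(2)]) auto
    show ?thesis
      by (rule has_derivative_eq_rhs[OF has_derivative_compose[OF Ck_on_SucD[OF Suc.prems(1) that] fD]])
        (rule ext, rule linear_axis_expansion[OF has_derivative_linear[OF fD]])
  qed
  have "Ck_on k S (\<lambda>x. frechet_derivative g (at x) v $ i * frechet_derivative f (at (g x)) (axis i 1))" for v i
    by (intro Ck_on_mult[OF assms(1)] Ck_on_component[OF assms(1)] Ck_on_frechet_derivative[OF Suc.prems(1)]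
        Suc.IH[OF Ck_on_Suc_imp[OF Suc.prems(1)] Ck_on_frechet_derivative[OF Suc.prems(2)]])
  then show ?case
    by (intro Ck_on_SucI[OF assms(1) D] Ck_on_sum[OF assms(1)])
qed

text \<open>The chain rule for an outer function on \<open>real\<close>, which is not of the form
  \<open>real ^ 'n\<close>; linearity in one variable replaces the axis expansion. It is used for
  compositions with \<open>flat_exp\<close>.\<close>

lemma Ck_on_compose_real:
  fixes f :: "real \<Rightarrow> real" and g :: "'a::real_normed_vector \<Rightarrow> real"
  assumes "open S" "Ck_on k S g" "Ck_on k UNIV f"
  shows "Ck_on k S (\<lambda>x. f (g x))"
  using assms(2,3)
proof (induction k arbitrary: f)
  case 0 then show ?case
    using continuous_on_compose2[of UNIV f S g] by auto
next
  case (Suc k)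
  have D: "((\<lambda>x. f (g x)) has_derivative
      (\<lambda>v. frechet_derivative g (at x) v * frechet_derivative f (at (g x)) 1)) (at x)"
    if "x \<in> S" for x
  proof -
    have fD: "(f has_derivative frechet_derivative f (at (g x))) (at (g x))"
      by (intro Ck_on_SucD[OF Suc.prems(2)]) auto
    have lin: "frechet_derivative f (at (g x)) w = w * frechet_derivative f (at (g x)) 1" for w
      using linear_cmul[OF has_derivative_linear[OF fD], of w 1] by simp
    show ?thesis
      by (rule has_derivative_eq_rhs[OF has_derivative_compose[OF Ck_on_SucD[OF Suc.prems(1) that] fD]])
        (rule ext, rule lin)
  qed
  have "Ck_on k S (\<lambda>x. frechet_derivative g (at x) v * frechet_derivative f (at (g x)) 1)" for v
    by (intro Ck_on_mult[OF assms(1)] Ck_on_frechet_derivative[OF Suc.prems(1)]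
        Suc.IH[OF Ck_on_Suc_imp[OF Suc.prems(1)] Ck_on_frechet_derivative[OF Suc.prems(2)]])
  then show ?case by (intro Ck_on_SucI[OF assms(1) D])
qed

section \<open>Smooth bump functions\<close>

text \<open>The functions \<open>t\<^sup>-\<^sup>n exp (- 1 / t)\<close>, extended by zero, are closed under differentiation up to
  linear combinations, which gives smoothness of the flat function \<open>n = 0\<close>.\<close>

definition flat_exp :: "nat \<Rightarrow> real \<Rightarrow> real" where
  "flat_exp n t = (if t > 0 then (1 / t) ^ n * exp (- (1 / t)) else 0)"

text \<open>Substituting y = 1/t turns the right-hand limit into that of y^n / exp y at
  infinity.\<close>

lemma flat_exp_tendsto_0: "(flat_exp n \<longlongrightarrow> 0) (at 0)"
proof -
  have "((\<lambda>y::real. y ^ n / exp y) \<longlongrightarrow> 0) at_top" by (rule tendsto_power_div_exp_0)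
  then have "((\<lambda>t::real. (inverse t) ^ n / exp (inverse t)) \<longlongrightarrow> 0) (at_right 0)"
    by (rule filterlim_compose[OF _ filterlim_inverse_at_top_right])
  then have "(flat_exp n \<longlongrightarrow> 0) (at_right 0)"
    by (rule Lim_transform_eventually)
      (auto simp: eventually_at_filter flat_exp_def exp_minus field_simps)
  moreover have "(flat_exp n \<longlongrightarrow> 0) (at_left 0)"
    by (rule Lim_transform_eventually[of "\<lambda>_. 0"])
      (auto simp: eventually_at_filter flat_exp_def)
  ultimately show ?thesis by (simp add: filterlim_at_split)
qed

lemma flat_exp_deriv:
  "(flat_exp n has_field_derivative flat_exp (n + 2) t - real n * flat_exp (Suc n) t) (at t)"
proof (cases t "0::real" rule: linorder_cases)
  case less
  have "((\<lambda>_. 0) has_field_derivative 0) (at t)" by simp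
  then have "(flat_exp n has_field_derivative 0) (at t)"
    by (rule has_field_derivative_transform_within_open[of _ _ _ "{..<0}"])
      (use less in \<open>auto simp: flat_exp_def\<close>)
  then show ?thesis using less by (simp add: flat_exp_def)
next
  case equal
  \<comment> \<open>The difference quotient of \<open>flat_exp n\<close> at 0 is
    \<open>flat_exp (Suc n)\<close>, which tends to 0.\<close>
  have "((\<lambda>h. flat_exp n (0 + h) / h) \<longlongrightarrow> 0) (at 0)"
    by (rule Lim_transform_eventually[OF flat_exp_tendsto_0[of "Suc n"]])
      (auto simp: eventually_at_filter flat_exp_def)
  then have "(flat_exp n has_field_derivative 0) (at 0)"
    unfolding DERIV_def by (simp add: flat_exp_def)
  then show ?thesis using equal by (simp add: flat_exp_def)
next
  case greater
  \<comment> \<open>The power rule leaves the exponent \<open>n - Suc 0\<close>; the coefficient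
    \<open>n\<close> makes this rewriting valid for \<open>n = 0\<close> too.\<close>
  have pow: "real n * (1 / t) ^ (n - Suc 0) = real n * (1 / t) ^ n * t"
    using greater by (cases n) auto
  have "((\<lambda>t. (1 / t) ^ n * exp (- (1 / t))) has_field_derivative
      (flat_exp (n + 2) t - real n * flat_exp (Suc n) t)) (at t)"
    using greater
    by (auto intro!: derivative_eq_intros simp: pow flat_exp_def) (auto simp: field_simps power2_eq_square)
  then show ?thesis
    by (rule has_field_derivative_transform_within_open[of _ _ _ "{0<..}"])
      (use greater in \<open>auto simp: flat_exp_def\<close>)
qed

lemma flat_exp_Ck: "Ck_on k UNIV (flat_exp n)"
proof (induction k arbitrary: n)
  case 0
  show ?case using flat_exp_deriv
    by (auto intro!: continuous_at_imp_continuous_on DERIV_isCont)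
next
  case (Suc k)
  have "Ck_on k UNIV (\<lambda>t. (flat_exp (n + 2) t + - real n * flat_exp (Suc n) t) * v)" for v
    by (intro Ck_on_mult Ck_on_add Ck_on_const Suc) auto
  then show ?case
    by (intro Ck_on_SucI[OF _ flat_exp_deriv[unfolded has_field_derivative_def]]) auto
qed

text \<open>Nesting \<open>flat_exp 0\<close> twice avoids quotients of smooth functions. In the
  small ball the inner copy vanishes, the outer one is evaluated at 1, and \<open>exp 1\<close>
  normalises its value. Outside the large ball the inner copy is so large, by monotonicity, that the
  outer argument is at most 0.\<close>

lemma smooth_bump:
  fixes y0 :: "'a::real_inner"
  assumes "0 < r"
  shows "\<exists>\<phi>::'a \<Rightarrow> real. \<exists>\<delta>>0. \<delta> < r \<and> smooth_on UNIV \<phi> \<and>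
    (\<forall>y\<in>ball y0 \<delta>. \<phi> y = 1) \<and> (\<forall>y. y \<notin> ball y0 r \<longrightarrow> \<phi> y = 0)"
proof -
  define \<delta> where "\<delta> = r / 2"
  \<comment> \<open>\<open>K\<close> is the reciprocal of the inner function on the sphere of radius
    \<open>r\<close>, so the outer argument is exactly 0 there.\<close>
  define K where "K = inverse (flat_exp 0 (r\<^sup>2 - \<delta>\<^sup>2))"
  define q where "q = (\<lambda>y::'a. (y - y0) \<bullet> (y - y0) + - \<delta>\<^sup>2)"
  define \<phi> where "\<phi> = (\<lambda>y::'a. exp 1 * flat_exp 0 (1 + - K * flat_exp 0 (q y)))"
  have pos: "r\<^sup>2 - \<delta>\<^sup>2 > 0" using assms by (simp add: \<delta>_def power2_eq_square field_simps)
  have Kpos: "K > 0" unfolding K_def using pos by (simp add: flat_exp_def)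
  have qC: "Ck_on k UNIV q" for k
  proof (cases k)
    case 0 then show ?thesis by (auto simp: q_def intro!: continuous_intros)
  next
    case (Suc k')
    have D: "(q has_derivative (\<lambda>v. 2 * (v \<bullet> (y - y0)))) (at y)" for y
      unfolding q_def by (auto intro!: derivative_eq_intros simp: inner_commute)
    have "Ck_on k' UNIV (\<lambda>y. 2 * (v \<bullet> y) + - 2 * (v \<bullet> y0))" for v
      by (intro Ck_on_add Ck_on_mult Ck_on_const Ck_on_linear bounded_linear_inner_right) auto
    then show ?thesis unfolding Suc by (intro Ck_on_SucI[OF _ D]) (auto simp: inner_diff_right algebra_simps)
  qed
  have "Ck_on k UNIV \<phi>" for k
    unfolding \<phi>_def
    by (intro Ck_on_mult Ck_on_add Ck_on_const Ck_on_compose_real[OF _ _ flat_exp_Ck] qC) auto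
  then have 1: "smooth_on UNIV \<phi>" by (simp add: smooth_on_def)
  have 2: "\<phi> y = 1" if "y \<in> ball y0 \<delta>" for y
  proof -
    have "norm (y - y0) < \<delta>" using that by (simp add: dist_norm norm_minus_commute)
    then have "(norm (y - y0))\<^sup>2 < \<delta>\<^sup>2" by (intro power_strict_mono) auto
    then have "q y < 0" by (simp add: q_def power2_norm_eq_inner)
    then show ?thesis by (simp add: \<phi>_def flat_exp_def exp_minus)
  qed
  have 3: "\<phi> y = 0" if "y \<notin> ball y0 r" for y
  proof -
    have "norm (y - y0) \<ge> r" using that by (simp add: dist_norm norm_minus_commute)
    then have "(norm (y - y0))\<^sup>2 \<ge> r\<^sup>2" using assms by (intro power_mono) auto
    then have le: "r\<^sup>2 - \<delta>\<^sup>2 \<le> q y" by (simp add: q_def power2_norm_eq_inner)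
    then have "flat_exp 0 (r\<^sup>2 - \<delta>\<^sup>2) \<le> flat_exp 0 (q y)"
      using pos by (simp add: flat_exp_def frac_le)
    then have "1 \<le> K * flat_exp 0 (q y)"
      using mult_left_mono[of "flat_exp 0 (r\<^sup>2 - \<delta>\<^sup>2)" "flat_exp 0 (q y)" K] Kpos pos
      by (simp add: K_def flat_exp_def)
    then show ?thesis by (simp add: \<phi>_def flat_exp_def)
  qed
  show ?thesis
    by (rule exI[of _ \<phi>], rule exI[of _ \<delta>]) (use 1 2 3 assms in \<open>auto simp: \<delta>_def\<close>)
qed

section \<open>Hadamard's lemma\<close>

text \<open>Each differentiation under the integral produces a factor \<open>t\<close>; the weight \<open>w\<close> absorbs it.\<close>

lemma Ck_on_ray_integral:
  fixes f :: "real ^ 'n::finite \<Rightarrow> real"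
  assumes "Ck_on k (ball y0 r) f" "continuous_on {0..1} w"
  shows "Ck_on k (ball y0 r) (\<lambda>y. integral {0..1} (\<lambda>t. w t * f (y0 + t *\<^sub>R (y - y0))))"
  using assms
proof (induction k arbitrary: f w)
  have seg: "y0 + t *\<^sub>R (y - y0) \<in> ball y0 r" if "y \<in> ball y0 r" "t \<in> {0..1}" for t y
  proof -
    have "dist y0 (y0 + t *\<^sub>R (y - y0)) = t * dist y0 y"
      using that by (simp add: dist_norm norm_minus_commute)
    also have "\<dots> \<le> 1 * dist y0 y" using that by (intro mult_right_mono) auto
    finally show ?thesis using that by auto
  qed
  have cont: "continuous_on (ball y0 r \<times> {0..1}) (\<lambda>z. w (snd z) * h (y0 + snd z *\<^sub>R (fst z - y0)))"
    if "continuous_on (ball y0 r) h" "continuous_on {0..1} w"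
    for h :: "real ^ 'n \<Rightarrow> real" and w
    by (intro continuous_intros continuous_on_compose2[OF that(2)] continuous_on_compose2[OF that(1)])
      (use seg in force)+
  {
    case 0
    show ?case
      using integral_continuous_on_param[of "ball y0 r" 0 1 "\<lambda>y t. w t * f (y0 + t *\<^sub>R (y - y0))"]
        cont[of f w] 0 by (simp add: split_beta')
  next
    case (Suc k)
    let ?P = "\<lambda>i y. frechet_derivative f (at y) (axis i 1)"
    let ?f = "\<lambda>y t. w t * f (y0 + t *\<^sub>R (y - y0))"
    let ?g = "\<lambda>y t i. (w t * t) * ?P i (y0 + t *\<^sub>R (y - y0))"
    \<comment> \<open>\<open>leibniz_rule\<close> takes derivatives as bounded linear maps. Writing
      them as partial derivatives times fixed coordinate projections reduces joint continuity in (y,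
      t) to scalar coefficients.\<close>
    let ?fx = "\<lambda>y t. \<Sum>i\<in>UNIV. ?g y t i *\<^sub>R blinfun_inner_left (axis i 1 :: real ^ 'n)"
    have contP: "continuous_on (ball y0 r) (?P i)" for i
    proof -
      have "Ck_on k (ball y0 r) (?P i)" using Suc.prems by auto
      then show ?thesis by (cases k) (auto intro!: continuous_at_imp_continuous_on differentiable_imp_continuous_within)
    qed
    have contw: "continuous_on {0..1} (\<lambda>t. w t * t)" by (intro continuous_intros Suc.prems)
    have contg: "continuous_on (ball y0 r \<times> {0..1}) (\<lambda>z. ?g (fst z) (snd z) i)" for i
      using cont[OF contP contw, of i] by simp
    have contf: "continuous_on (ball y0 r) f"
      using Suc.prems(1)
      by (auto intro!: continuous_at_imp_continuous_on differentiable_imp_continuous_within)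
    have fx: "((\<lambda>y. ?f y t) has_derivative blinfun_apply (?fx y t)) (at y within ball y0 r)"
      if "y \<in> ball y0 r" "t \<in> cbox 0 1" for y t
    proof -
      let ?z = "y0 + t *\<^sub>R (y - y0)"
      have z: "?z \<in> ball y0 r" using seg that by auto
      have fD: "(f has_derivative frechet_derivative f (at ?z)) (at ?z)"
        by (rule Ck_on_SucD[OF Suc.prems(1) z])
      have lin: "linear (frechet_derivative f (at ?z))" by (rule has_derivative_linear[OF fD])
      have "((\<lambda>y. y0 + t *\<^sub>R (y - y0)) has_derivative (\<lambda>v. t *\<^sub>R v)) (at y within ball y0 r)"
        by (auto intro!: derivative_eq_intros)
      then have "((\<lambda>y. f (y0 + t *\<^sub>R (y - y0))) has_derivative (\<lambda>v. frechet_derivative f (at ?z) (t *\<^sub>R v))) (at y within ball y0 r)"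
        by (rule has_derivative_compose[where f = "\<lambda>y. y0 + t *\<^sub>R (y - y0)", OF _ fD])
      then have "((\<lambda>y. ?f y t) has_derivative (\<lambda>v. w t * frechet_derivative f (at ?z) (t *\<^sub>R v))) (at y within ball y0 r)"
        by (rule has_derivative_mult_right)
      moreover have "w t * frechet_derivative f (at ?z) (t *\<^sub>R v) = blinfun_apply (?fx y t) v" for v
        unfolding linear_cmul[OF lin] linear_axis_expansion[OF lin, of v]
        by (simp add: blinfun.sum_left blinfun.scaleR_left inner_axis sum_distrib_left algebra_simps)
      ultimately show ?thesis by simp
    qed
    have int: "?f y integrable_on cbox 0 1" if "y \<in> ball y0 r" for y
    proof -
      have "continuous_on {0..1} (\<lambda>t. w t * f (y0 + t *\<^sub>R (y - y0)))"
        by (intro continuous_intros Suc.prems(2) continuous_on_compose2[OF contf])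
          (use seg that in auto)
      then show ?thesis by (simp add: integrable_continuous_interval)
    qed
    have intg: "(\<lambda>t. ?g y t i) integrable_on {0..1}" if "y \<in> ball y0 r" for y i
    proof -
      have "continuous_on {0..1} (\<lambda>t. ?g y t i)"
        by (intro continuous_intros Suc.prems(2) continuous_on_compose2[OF contP])
          (use seg that in auto)
      then show ?thesis by (rule integrable_continuous_interval)
    qed
    have cfx: "continuous_on (ball y0 r \<times> cbox 0 1) (\<lambda>(y, t). ?fx y t)"
      unfolding split_beta' cbox_interval by (intro continuous_on_sum continuous_on_scaleR continuous_on_const contg)
    have D: "((\<lambda>y. integral {0..1} (?f y)) has_derivative
        (\<lambda>v. \<Sum>i\<in>UNIV. integral {0..1} (\<lambda>t. ?g y t i) * v $ i)) (at y)" if y: "y \<in> ball y0 r" for y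
    proof -
      have "((\<lambda>y. integral (cbox 0 1) (?f y)) has_derivative blinfun_apply (integral (cbox 0 1) (?fx y))) (at y within ball y0 r)"
        by (rule leibniz_rule[OF fx int cfx y]) auto
      then have 1: "((\<lambda>y. integral {0..1} (?f y)) has_derivative blinfun_apply (integral {0..1} (?fx y))) (at y)"
        using at_within_open[OF y] by (simp add: cbox_interval)
      have "((?fx y) has_integral (\<Sum>i\<in>UNIV. integral {0..1} (\<lambda>t. ?g y t i) *\<^sub>R blinfun_inner_left (axis i 1 :: real ^ 'n))) {0..1}"
        by (intro has_integral_sum has_integral_scaleR_left integrable_integral intg[OF y]) auto
      then have "integral {0..1} (?fx y) = (\<Sum>i\<in>UNIV. integral {0..1} (\<lambda>t. ?g y t i) *\<^sub>R blinfun_inner_left (axis i 1 :: real ^ 'n))"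
        by (rule integral_unique)
      then have "blinfun_apply (integral {0..1} (?fx y)) = (\<lambda>v. \<Sum>i\<in>UNIV. integral {0..1} (\<lambda>t. ?g y t i) * v $ i)"
        by (simp add: fun_eq_iff blinfun.sum_left blinfun.scaleR_left inner_axis)
      then show ?thesis using 1 by simp
    qed
    have "Ck_on k (ball y0 r) (\<lambda>y. integral {0..1} (\<lambda>t. ?g y t i))" for i
      by (rule Suc.IH[OF _ contw]) (use Suc.prems in auto)
    then show ?case
      by (intro Ck_on_SucI[OF _ D] Ck_on_sum Ck_on_mult Ck_on_const) auto
  }
qed

text \<open>\<open>h i\<close> is the average of the i-th partial derivative over the segment from
  \<open>y0\<close> to \<open>y\<close>. The fundamental theorem of calculus along the segment gives
  the expansion; for \<open>y = y0\<close> the integrand is constant.\<close>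

lemma hadamard:
  fixes f :: "real ^ 'n::finite \<Rightarrow> real"
  assumes "smooth_on (ball y0 r) f" "0 < r"
  shows "\<exists>h. (\<forall>i. smooth_on (ball y0 r) (h i)) \<and>
    (\<forall>i. h i y0 = frechet_derivative f (at y0) (axis i 1)) \<and>
    (\<forall>y\<in>ball y0 r. f y = f y0 + (\<Sum>i\<in>UNIV. (y $ i - y0 $ i) * h i y))"
proof -
  let ?P = "\<lambda>i y. frechet_derivative f (at y) (axis i 1)"
  define h where "h = (\<lambda>i y. integral {0..1} (\<lambda>t. ?P i (y0 + t *\<^sub>R (y - y0))))"
  have Ck: "Ck_on k (ball y0 r) f" for k using assms by (simp add: smooth_on_def)
  have CkP: "Ck_on k (ball y0 r) (?P i)" for k i using Ck[of "Suc k"] by auto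
  have "Ck_on k (ball y0 r) (h i)" for k i
    using Ck_on_ray_integral[OF CkP[of k i], of "\<lambda>_. 1"] by (simp add: h_def)
  moreover have "h i y0 = ?P i y0" for i by (simp add: h_def)
  moreover have "f y = f y0 + (\<Sum>i\<in>UNIV. (y $ i - y0 $ i) * h i y)" if y: "y \<in> ball y0 r" for y
  proof -
    have seg: "y0 + t *\<^sub>R (y - y0) \<in> ball y0 r" if "t \<in> {0..1}" for t
    proof -
      have "dist y0 (y0 + t *\<^sub>R (y - y0)) = t * dist y0 y"
        using that by (simp add: dist_norm norm_minus_commute)
      also have "\<dots> \<le> 1 * dist y0 y" using that by (intro mult_right_mono) auto
      finally show ?thesis using y by auto
    qed
    have int: "(\<lambda>t. ?P i (y0 + t *\<^sub>R (y - y0))) integrable_on {0..1}" for i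
      by (intro integrable_continuous_interval continuous_on_compose2[OF CkP[of 0 i, simplified]] continuous_intros)
        (use seg in auto)
    have D: "((\<lambda>t. f (y0 + t *\<^sub>R (y - y0))) has_vector_derivative
        (\<Sum>i\<in>UNIV. (y $ i - y0 $ i) * ?P i (y0 + t *\<^sub>R (y - y0)))) (at t within {0..1})"
      if "t \<in> {0..1}" for t
    proof -
      let ?z = "y0 + t *\<^sub>R (y - y0)"
      have fD: "(f has_derivative frechet_derivative f (at ?z)) (at ?z)"
        by (rule Ck_on_SucD[OF Ck[of "Suc 0"] seg[OF that]])
      have lin: "linear (frechet_derivative f (at ?z))" by (rule has_derivative_linear[OF fD])
      have "((\<lambda>t. y0 + t *\<^sub>R (y - y0)) has_derivative (\<lambda>s. s *\<^sub>R (y - y0))) (at t within {0..1})"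
        by (auto intro!: derivative_eq_intros)
      from has_derivative_compose[where f = "\<lambda>t. y0 + t *\<^sub>R (y - y0)", OF this fD]
      show ?thesis unfolding has_vector_derivative_def
        unfolding linear_cmul[OF lin] linear_axis_expansion[OF lin, of "y - y0"] by simp
    qed
    have "((\<lambda>t. \<Sum>i\<in>UNIV. (y $ i - y0 $ i) * ?P i (y0 + t *\<^sub>R (y - y0))) has_integral
        f (y0 + 1 *\<^sub>R (y - y0)) - f (y0 + 0 *\<^sub>R (y - y0))) {0..1}"
      by (rule fundamental_theorem_of_calculus) (use D in auto)
    moreover have "((\<lambda>t. \<Sum>i\<in>UNIV. (y $ i - y0 $ i) * ?P i (y0 + t *\<^sub>R (y - y0))) has_integral
        (\<Sum>i\<in>UNIV. (y $ i - y0 $ i) * h i y)) {0..1}"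
      unfolding h_def by (intro has_integral_sum has_integral_mult_right integrable_integral int) auto
    ultimately have "f (y0 + 1 *\<^sub>R (y - y0)) - f (y0 + 0 *\<^sub>R (y - y0)) = (\<Sum>i\<in>UNIV. (y $ i - y0 $ i) * h i y)"
      by (rule has_integral_unique)
    then show ?thesis by simp
  qed
  ultimately show ?thesis unfolding smooth_on_def by (intro exI[of _ h]) auto
qed

section \<open>Charts and smooth functions\<close>

lemma smooth_on_add:
  "open S \<Longrightarrow> smooth_on S f \<Longrightarrow> smooth_on S g \<Longrightarrow> smooth_on S (\<lambda>x. f x + g x)"
  by (simp add: smooth_on_def Ck_on_add)

lemma smooth_on_mult:
  fixes f g :: "'a::real_normed_vector \<Rightarrow> real"
  shows "open S \<Longrightarrow> smooth_on S f \<Longrightarrow> smooth_on S g \<Longrightarrow> smooth_on S (\<lambda>x. f x * g x)"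
  by (simp add: smooth_on_def Ck_on_mult)

lemma smooth_on_const: "open S \<Longrightarrow> smooth_on S (\<lambda>x. c)"
  by (simp add: smooth_on_def Ck_on_const)

lemma smooth_on_linear: "open S \<Longrightarrow> bounded_linear f \<Longrightarrow> smooth_on S f"
  by (simp add: smooth_on_def Ck_on_linear)

lemma smooth_on_subset: "smooth_on S f \<Longrightarrow> T \<subseteq> S \<Longrightarrow> smooth_on T f"
  by (auto simp: smooth_on_def intro: Ck_on_subset)

lemma smooth_on_frechet_derivative:
  "smooth_on S f \<Longrightarrow> smooth_on S (\<lambda>x. frechet_derivative f (at x) v)"
  unfolding smooth_on_def using Ck_on_frechet_derivative by blast

lemma smooth_on_differentiable: "smooth_on S f \<Longrightarrow> x \<in> S \<Longrightarrow> f differentiable (at x)"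
  unfolding smooth_on_def using Ck_on.simps(2)[of 0 S f] by blast

lemma chart_open_image:
  assumes "is_chart c" "open W" "W \<subseteq> fst c"
  shows "open (snd c ` W)"
proof -
  have hom: "homeomorphism (fst c) (snd c ` fst c) (snd c) (chart_inv c)"
    and op: "open (snd c ` fst c)" using assms(1) by (auto simp: is_chart_def)
  have "snd c ` W = snd c ` fst c \<inter> chart_inv c -` W"
    using hom assms(3) by (auto simp: homeomorphism_def image_iff)
  then show ?thesis
    using continuous_open_preimage[of "snd c ` fst c" "chart_inv c" W] hom op assms(2)
    by (simp add: homeomorphism_def)
qed

lemma chart_inv_chart: "is_chart c \<Longrightarrow> q \<in> fst c \<Longrightarrow> chart_inv c (snd c q) = q"
  by (auto simp: is_chart_def homeomorphism_def)

lemma chart_open_preimage: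
  assumes "is_chart c" "open W" "W \<subseteq> fst c" "open B"
  shows "open {q \<in> W. snd c q \<in> B}"
proof -
  have "continuous_on W (snd c)"
    using assms(1,3) by (auto simp: is_chart_def homeomorphism_def intro: continuous_on_subset)
  from continuous_open_preimage[OF this assms(2,4)] show ?thesis
    by (simp add: Int_def vimage_def)
qed

lemma smooth_structure_chart: "smooth_structure \<A> \<Longrightarrow> c \<in> \<A> \<Longrightarrow> is_chart c"
  unfolding smooth_structure_def by blast

lemma smooth_functionsI:
  assumes "smooth_structure \<A>"
    and "\<And>c. c \<in> \<A> \<Longrightarrow> open (snd c ` fst c) \<Longrightarrow> smooth_on (snd c ` fst c) (\<lambda>y. f (chart_inv c y))"
  shows "f \<in> smooth_functions \<A>"
  using assms(2) smooth_structure_chart[OF assms(1)] by (simp add: smooth_functions_def comp_def is_chart_def)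

lemma smooth_functionsD:
  "f \<in> smooth_functions \<A> \<Longrightarrow> c \<in> \<A> \<Longrightarrow> smooth_on (snd c ` fst c) (\<lambda>y. f (chart_inv c y))"
  by (simp add: smooth_functions_def comp_def)

lemma smooth_functions_add:
  assumes "smooth_structure \<A>" "f \<in> smooth_functions \<A>" "g \<in> smooth_functions \<A>"
  shows "(\<lambda>q. f q + g q) \<in> smooth_functions \<A>"
  by (intro smooth_functionsI[OF assms(1)] smooth_on_add smooth_functionsD[OF assms(2)] smooth_functionsD[OF assms(3)])

lemma smooth_functions_mult:
  assumes "smooth_structure \<A>" "f \<in> smooth_functions \<A>" "g \<in> smooth_functions \<A>"
  shows "(\<lambda>q. f q * g q) \<in> smooth_functions \<A>"
  by (intro smooth_functionsI[OF assms(1)] smooth_on_mult smooth_functionsD[OF assms(2)] smooth_functionsD[OF assms(3)])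

lemma smooth_functions_const:
  assumes "smooth_structure \<A>"
  shows "(\<lambda>q. r) \<in> smooth_functions \<A>"
  by (intro smooth_functionsI[OF assms(1)] smooth_on_const)

lemma smooth_functions_cmult:
  assumes "smooth_structure \<A>" "f \<in> smooth_functions \<A>"
  shows "(\<lambda>q. r * f q) \<in> smooth_functions \<A>"
  by (rule smooth_functions_mult[OF assms(1) smooth_functions_const[OF assms(1)] assms(2)])

lemma smooth_functions_diff:
  assumes "smooth_structure \<A>" "f \<in> smooth_functions \<A>" "g \<in> smooth_functions \<A>"
  shows "(\<lambda>q. f q - g q) \<in> smooth_functions \<A>"
  using smooth_functions_add[OF assms(1,2) smooth_functions_cmult[OF assms(1,3), of "-1"]] by simp

lemma smooth_functions_sum:
  assumes "smooth_structure \<A>" "\<And>k. k \<in> I \<Longrightarrow> f k \<in> smooth_functions \<A>"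
  shows "(\<lambda>q. \<Sum>k\<in>I. f k q) \<in> smooth_functions \<A>"
  using assms(2)
proof (induction I rule: infinite_finite_induct)
  case (insert i I)
  then show ?case using smooth_functions_add[OF assms(1), of "f i" "\<lambda>q. \<Sum>k\<in>I. f k q"] by simp
qed (simp_all add: smooth_functions_const assms(1))

text \<open>The device that turns functions on a chart into globally smooth ones. One
  \<open>\<phi>\<close> serves all \<open>h\<close>: coordinates, partial derivatives of smooth
  functions, Hadamard coefficients, and the constant 1, which recovers \<open>\<phi>\<close>
  itself.\<close>

lemma cutoff_smooth:
  fixes \<A> :: "('m::{t2_space, second_countable_topology}, 'n::finite) chart set"
  assumes sm: "smooth_structure \<A>" and c: "(U, x) \<in> \<A>"
    and W: "open W" "W \<subseteq> U" "p \<in> W"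
  shows "\<exists>\<phi> V. open V \<and> p \<in> V \<and> V \<subseteq> W \<and> (\<forall>q\<in>V. \<phi> q = 1) \<and> (\<forall>q. q \<notin> W \<longrightarrow> \<phi> q = 0) \<and>
    (\<forall>h. smooth_on (x ` W) h \<longrightarrow> (\<lambda>q. if q \<in> W then \<phi> q * h (x q) else 0) \<in> smooth_functions \<A>)"
proof -
  let ?c = "(U, x)"
  note ch = smooth_structure_chart[OF sm]
  have chU: "is_chart ?c" by (rule ch[OF c])
  have oxW: "open (x ` W)" using chart_open_image[OF chU W(1)] W(2) by simp
  then obtain r where r: "r > 0" "cball (x p) r \<subseteq> x ` W"
    using W(3) open_contains_cball by blast
  obtain \<phi>0 :: "real ^ 'n \<Rightarrow> real" and \<delta> where \<delta>: "\<delta> > 0" "\<delta> < r" and sm0: "smooth_on UNIV \<phi>0"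
    and one: "\<forall>y\<in>ball (x p) \<delta>. \<phi>0 y = 1" and zero: "\<forall>y. y \<notin> ball (x p) r \<longrightarrow> \<phi>0 y = 0"
    using smooth_bump[OF r(1), of "x p"] by blast
  \<comment> \<open>\<open>K\<close> contains every point where the cutoff is nonzero. It is
    compact, hence closed, so each point outside \<open>W\<close> has the neighbourhood
    \<open>- K\<close> on which the extension by zero vanishes identically.\<close>
  define K where "K = chart_inv ?c ` cball (x p) r"
  have xWU: "x ` W \<subseteq> x ` U" using W by auto
  have "compact K" unfolding K_def
    by (rule compact_continuous_image)
      (use chU continuous_on_subset[OF _ order_trans[OF r(2) xWU], of "chart_inv ?c"] in
        \<open>auto simp: is_chart_def homeomorphism_def\<close>)
  then have clK: "closed K" by (rule compact_imp_closed)
  have KW: "K \<subseteq> W"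
  proof
    fix q assume "q \<in> K"
    then obtain y where y: "y \<in> cball (x p) r" "q = chart_inv ?c y" by (auto simp: K_def)
    then obtain z where "z \<in> W" "y = x z" using r by blast
    then show "q \<in> W" using y chart_inv_chart[OF chU, of z] W by auto
  qed
  have outK: "\<phi>0 (x q) = 0" if "q \<in> W" "q \<notin> K" for q
  proof -
    have "x q \<notin> cball (x p) r"
    proof
      assume "x q \<in> cball (x p) r"
      then have "chart_inv ?c (x q) \<in> K" by (auto simp: K_def)
      then show False using that chart_inv_chart[OF chU, of q] W by auto
    qed
    then show ?thesis using zero by auto
  qed
  define \<phi> where "\<phi> = (\<lambda>q. if q \<in> W then \<phi>0 (x q) else 0)"
  define V where "V = {q \<in> W. x q \<in> ball (x p) \<delta>}"
  have V: "open V" unfolding V_def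
    using chart_open_preimage[OF chU W(1), of "ball (x p) \<delta>"] W(2) by simp
  have main: "(\<lambda>q. if q \<in> W then \<phi> q * h (x q) else 0) \<in> smooth_functions \<A>" (is "?F \<in> _")
    if h: "smooth_on (x ` W) h" for h
  proof -
    have "Ck_on k (snd c' ` fst c') (?F \<circ> chart_inv c')" if c': "c' \<in> \<A>" for c' k
    proof (rule Ck_on_local)
      fix y assume "y \<in> snd c' ` fst c'"
      then obtain q where q: "q \<in> fst c'" "y = snd c' q" by auto
      have chc': "is_chart c'" by (rule ch[OF c'])
      have opU': "open (fst c')" using chc' by (simp add: is_chart_def)
      show "\<exists>T. open T \<and> y \<in> T \<and> Ck_on k T (?F \<circ> chart_inv c')"
      proof (cases "q \<in> W")
        \<comment> \<open>Near a point of \<open>W\<close> the function is a product that is smooth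
          in the coordinates \<open>x\<close>, composed with the transition map from
          \<open>c'\<close>.\<close>
        case True
        let ?T = "snd c' ` (fst c' \<inter> W)"
        have T: "open ?T" using chart_open_image[OF chc', of "fst c' \<inter> W"] opU' W by auto
        have "compatible ?c c'" using sm c c' unfolding smooth_structure_def by blast
        then have "Ck_on k (snd c' ` (U \<inter> fst c')) (x \<circ> chart_inv c')"
          by (auto simp: compatible_def smooth_on_def)
        then have g: "Ck_on k ?T (x \<circ> chart_inv c')" by (rule Ck_on_subset) (use W in auto)
        have f: "Ck_on k (x ` W) (\<lambda>y. \<phi>0 y * h y)"
          using smooth_on_mult[OF oxW smooth_on_subset[OF sm0] h] by (simp add: smooth_on_def)
        have "Ck_on k ?T (\<lambda>y. (\<lambda>y. \<phi>0 y * h y) ((x \<circ> chart_inv c') y))"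
          by (rule Ck_on_compose[OF T oxW _ g f]) (auto simp: chart_inv_chart[OF chc'])
        then have "Ck_on k ?T (?F \<circ> chart_inv c')"
          by (rule Ck_on_cong_imp[OF T, rotated]) (auto simp: chart_inv_chart[OF chc'] \<phi>_def)
        then show ?thesis using T q True by auto
      next
        case False
        let ?T = "snd c' ` (fst c' - K)"
        have T: "open ?T" using chart_open_image[OF chc', of "fst c' - K"] opU' clK by auto
        have "Ck_on k ?T (?F \<circ> chart_inv c')"
          by (rule Ck_on_cong_imp[OF T _ Ck_on_const[OF T, of k 0]])
            (auto simp: chart_inv_chart[OF chc'] \<phi>_def outK)
        then show ?thesis using T q False KW by auto
      qed
    qed
    then show ?thesis by (auto simp: smooth_functions_def smooth_on_def)
  qed
  have "V \<subseteq> W" "p \<in> V" "\<forall>q\<in>V. \<phi> q = 1" "\<forall>q. q \<notin> W \<longrightarrow> \<phi> q = 0"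
    using W one \<delta> by (auto simp: V_def \<phi>_def)
  then show ?thesis using V main by blast
qed

section \<open>Partial derivatives\<close>

lemma partial_cong:
  assumes "is_chart c" "open N" "p \<in> N" "p \<in> fst c" "\<And>q. q \<in> N \<Longrightarrow> f q = g q"
  shows "partial c i f p = partial c i g p"
proof -
  have op: "open (fst c)" using assms(1) by (simp add: is_chart_def)
  have "open (snd c ` (N \<inter> fst c))"
    using chart_open_image[OF assms(1), of "N \<inter> fst c"] op assms(2) by auto
  then show ?thesis unfolding partial_def
    by (subst frechet_derivative_cong_open[of "snd c ` (N \<inter> fst c)" _ "f \<circ> chart_inv c" "g \<circ> chart_inv c"])
      (use assms chart_inv_chart[OF assms(1)] in auto)
qed

lemma partial_const: "partial c i (\<lambda>q. r) p = 0"
  by (simp add: partial_def comp_def)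

lemma smooth_functions_has_derivative:
  assumes "f \<in> smooth_functions \<A>" "c \<in> \<A>" "p \<in> fst c"
  shows "(f \<circ> chart_inv c has_derivative frechet_derivative (f \<circ> chart_inv c) (at (snd c p))) (at (snd c p))"
proof -
  have "(f \<circ> chart_inv c) differentiable (at (snd c p))"
    using assms smooth_on_differentiable[of "snd c ` fst c"] by (auto simp: smooth_functions_def)
  then show ?thesis by (simp add: frechet_derivative_works[symmetric])
qed

lemma partial_add:
  assumes "f \<in> smooth_functions \<A>" "g \<in> smooth_functions \<A>" "c \<in> \<A>" "p \<in> fst c"
  shows "partial c i (\<lambda>q. f q + g q) p = partial c i f p + partial c i g p"
  using fun_cong[OF frechet_derivative_at[OF has_derivative_add[OF smooth_functions_has_derivative[OF assms(1,3,4)]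
      smooth_functions_has_derivative[OF assms(2,3,4)]]], of "axis i 1"]
  by (simp add: partial_def comp_def)

lemma partial_mult:
  assumes "smooth_structure \<A>" "f \<in> smooth_functions \<A>" "g \<in> smooth_functions \<A>" "c \<in> \<A>" "p \<in> fst c"
  shows "partial c i (\<lambda>q. f q * g q) p = partial c i f p * g p + f p * partial c i g p"
proof -
  have "is_chart c" by (rule smooth_structure_chart[OF assms(1,4)])
  then show ?thesis
    using fun_cong[OF frechet_derivative_at[OF has_derivative_mult[OF smooth_functions_has_derivative[OF assms(2,4,5)]
      smooth_functions_has_derivative[OF assms(3,4,5)]]], of "axis i 1"]
    by (simp add: partial_def comp_def chart_inv_chart assms(5))
qed

lemma partial_cmult:
  assumes "smooth_structure \<A>" "f \<in> smooth_functions \<A>" "c \<in> \<A>" "p \<in> fst c"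
  shows "partial c i (\<lambda>q. r * f q) p = r * partial c i f p"
  using partial_mult[OF assms(1) smooth_functions_const[OF assms(1)] assms(2-4), of i r]
  by (simp add: partial_const)

section \<open>Tangent and cotangent spaces\<close>

lemma tangent_add_fun:
  "v \<in> tangent_space \<A> p \<Longrightarrow> f \<in> smooth_functions \<A> \<Longrightarrow> g \<in> smooth_functions \<A> \<Longrightarrow>
    v (\<lambda>q. f q + g q) = v f + v g"
  by (simp add: tangent_space_def)

lemma tangent_mult_fun:
  "v \<in> tangent_space \<A> p \<Longrightarrow> f \<in> smooth_functions \<A> \<Longrightarrow> g \<in> smooth_functions \<A> \<Longrightarrow>
    v (\<lambda>q. f q * g q) = v f * g p + f p * v g"
  by (simp add: tangent_space_def)

lemma tangent_cmult_fun:
  "v \<in> tangent_space \<A> p \<Longrightarrow> f \<in> smooth_functions \<A> \<Longrightarrow> v (\<lambda>q. r * f q) = r * v f"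
  by (simp add: tangent_space_def)

lemma tangent_not_smooth:
  "v \<in> tangent_space \<A> p \<Longrightarrow> f \<notin> smooth_functions \<A> \<Longrightarrow> v f = 0"
  by (simp add: tangent_space_def)

lemma tangent_const:
  assumes "smooth_structure \<A>" "v \<in> tangent_space \<A> p"
  shows "v (\<lambda>q. r) = 0"
proof -
  \<comment> \<open>The Leibniz rule for 1 = 1 * 1 gives v(1) = 2 v(1).\<close>
  have "v (\<lambda>q. 1) = 0"
    using tangent_mult_fun[OF assms(2) smooth_functions_const[OF assms(1)] smooth_functions_const[OF assms(1)], of 1 1]
    by simp
  then show ?thesis
    using tangent_cmult_fun[OF assms(2) smooth_functions_const[OF assms(1)], of r 1] by simp
qed

lemma tangent_diff_fun:
  assumes "smooth_structure \<A>" "v \<in> tangent_space \<A> p" "f \<in> smooth_functions \<A>" "g \<in> smooth_functions \<A>"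
  shows "v (\<lambda>q. f q - g q) = v f - v g"
  using tangent_add_fun[OF assms(2,3) smooth_functions_cmult[OF assms(1,4)], of "-1"]
    tangent_cmult_fun[OF assms(2,4), of "-1"] by simp

lemma tangent_sum_fun:
  assumes "smooth_structure \<A>" "v \<in> tangent_space \<A> p" "\<And>k. k \<in> I \<Longrightarrow> f k \<in> smooth_functions \<A>"
  shows "v (\<lambda>q. \<Sum>k\<in>I. f k q) = (\<Sum>k\<in>I. v (f k))"
  using assms(3)
proof (induction I rule: infinite_finite_induct)
  case (insert i I)
  then show ?case
    using tangent_add_fun[OF assms(2), of "f i" "\<lambda>q. \<Sum>k\<in>I. f k q"] smooth_functions_sum[OF assms(1), of I f]
    by simp
qed (simp_all add: tangent_const[OF assms(1,2)])

text \<open>Multiply \<open>f - g\<close> by a cutoff supported in \<open>N\<close> with value 1 at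
  \<open>p\<close>. The product is the zero function, and since \<open>f - g\<close> vanishes at
  \<open>p\<close>, the Leibniz rule leaves only v(f - g).\<close>

lemma tangent_local:
  fixes \<A> :: "('m::{t2_space, second_countable_topology}, 'n::finite) chart set"
  assumes sm: "smooth_structure \<A>" and v: "v \<in> tangent_space \<A> p"
    and f: "f \<in> smooth_functions \<A>" and g: "g \<in> smooth_functions \<A>"
    and N: "open N" "p \<in> N" and eq: "\<And>q. q \<in> N \<Longrightarrow> f q = g q"
  shows "v f = v g"
proof -
  obtain U x where c: "(U, x) \<in> \<A>" "p \<in> U"
    using sm unfolding smooth_structure_def by (metis UNIV_I UN_E prod.collapse)
  have "is_chart (U, x)" by (rule smooth_structure_chart[OF sm c(1)])
  then have "open U" by (simp add: is_chart_def)
  then have "open (N \<inter> U)" "N \<inter> U \<subseteq> U" "p \<in> N \<inter> U" using N c by auto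
  from cutoff_smooth[OF sm c(1) this] obtain \<phi> V where V: "open V" "p \<in> V" "\<forall>q\<in>V. \<phi> q = 1" "\<forall>q. q \<notin> N \<inter> U \<longrightarrow> \<phi> q = 0"
    and h: "\<forall>h. smooth_on (x ` (N \<inter> U)) h \<longrightarrow> (\<lambda>q. if q \<in> N \<inter> U then \<phi> q * h (x q) else 0) \<in> smooth_functions \<A>"
    by blast
  have "open (x ` (N \<inter> U))"
    using chart_open_image[OF \<open>is_chart (U, x)\<close>, of "N \<inter> U"] N \<open>open U\<close> by auto
  \<comment> \<open>The choice h = 1 shows that the cutoff itself is globally smooth.\<close>
  then have "(\<lambda>q. if q \<in> N \<inter> U then \<phi> q * 1 else 0) \<in> smooth_functions \<A>"
    using h smooth_on_const by blast
  moreover have "(\<lambda>q. if q \<in> N \<inter> U then \<phi> q * 1 else 0) = \<phi>" using V by auto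
  ultimately have \<phi>: "\<phi> \<in> smooth_functions \<A>" by simp
  have "(\<lambda>q. \<phi> q * (f q - g q)) = (\<lambda>q. 0)" using V eq by (auto simp: fun_eq_iff)
  then have "0 = v (\<lambda>q. \<phi> q * (f q - g q))" using tangent_const[OF sm v] by simp
  also have "\<dots> = v (\<lambda>q. f q - g q)"
    using tangent_mult_fun[OF v \<phi> smooth_functions_diff[OF sm f g]] V N eq by simp
  finally show ?thesis using tangent_diff_fun[OF sm v f g] by simp
qed

lemma tangent_space_zero: "0 \<in> tangent_space \<A> p"
  by (simp add: tangent_space_def)

lemma tangent_space_add:
  "v \<in> tangent_space \<A> p \<Longrightarrow> w \<in> tangent_space \<A> p \<Longrightarrow> v + w \<in> tangent_space \<A> p"
  by (simp add: tangent_space_def algebra_simps)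

lemma tangent_space_scaleR: "v \<in> tangent_space \<A> p \<Longrightarrow> r *\<^sub>R v \<in> tangent_space \<A> p"
  by (simp add: tangent_space_def scaleR_fun_def algebra_simps)

lemma tangent_space_sum:
  "(\<And>k. k \<in> I \<Longrightarrow> v k \<in> tangent_space \<A> p) \<Longrightarrow> (\<Sum>k\<in>I. v k) \<in> tangent_space \<A> p"
  by (induction I rule: infinite_finite_induct) (simp_all add: tangent_space_add tangent_space_zero)

lemma cotangent_add:
  "\<omega> \<in> cotangent_space \<A> p \<Longrightarrow> v \<in> tangent_space \<A> p \<Longrightarrow> w \<in> tangent_space \<A> p \<Longrightarrow>
    \<omega> (v + w) = \<omega> v + \<omega> w"
  unfolding cotangent_space_def mem_Collect_eq by blast

lemma cotangent_scaleR:
  "\<omega> \<in> cotangent_space \<A> p \<Longrightarrow> v \<in> tangent_space \<A> p \<Longrightarrow> \<omega> (r *\<^sub>R v) = r * \<omega> v"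
  unfolding cotangent_space_def mem_Collect_eq by blast

lemma cotangent_not_tangent:
  "\<omega> \<in> cotangent_space \<A> p \<Longrightarrow> v \<notin> tangent_space \<A> p \<Longrightarrow> \<omega> v = 0"
  unfolding cotangent_space_def mem_Collect_eq by blast

lemma cotangent_zero:
  assumes "\<omega> \<in> cotangent_space \<A> p"
  shows "\<omega> 0 = 0"
  using cotangent_scaleR[OF assms tangent_space_zero, of 0] by (simp only: scale_zero_left mult_zero_left)

lemma cotangent_sum:
  assumes "\<omega> \<in> cotangent_space \<A> p" "\<And>k. k \<in> I \<Longrightarrow> v k \<in> tangent_space \<A> p"
  shows "\<omega> (\<Sum>k\<in>I. r k *\<^sub>R v k) = (\<Sum>k\<in>I. r k * \<omega> (v k))"
  using assms(2)
proof (induction I rule: infinite_finite_induct)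
  case (insert i I)
  have "\<omega> (r i *\<^sub>R v i + (\<Sum>k\<in>I. r k *\<^sub>R v k)) = \<omega> (r i *\<^sub>R v i) + \<omega> (\<Sum>k\<in>I. r k *\<^sub>R v k)"
    by (intro cotangent_add[OF assms(1)] tangent_space_sum tangent_space_scaleR insert.prems) simp_all
  moreover have "\<omega> (r i *\<^sub>R v i) = r i * \<omega> (v i)"
    by (intro cotangent_scaleR[OF assms(1)] insert.prems) simp
  moreover have "\<omega> (\<Sum>k\<in>I. r k *\<^sub>R v k) = (\<Sum>k\<in>I. r k * \<omega> (v k))"
    by (rule insert.IH) (simp add: insert.prems)
  ultimately show ?case unfolding sum.insert[OF insert.hyps] by (simp only:)
qed (simp_all add: cotangent_zero[OF assms(1)])

lemma coord_vec_tangent: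
  assumes sm: "smooth_structure \<A>" and "c \<in> \<A>" "p \<in> fst c"
  shows "coord_vec \<A> c i p \<in> tangent_space \<A> p"
  unfolding tangent_space_def coord_vec_def mem_Collect_eq
  by (simp add: smooth_functions_add[OF sm] smooth_functions_mult[OF sm] smooth_functions_cmult[OF sm]
      partial_add[OF _ _ assms(2,3)] partial_mult[OF sm _ _ assms(2,3)] partial_cmult[OF sm _ assms(2,3)])

text \<open>Two applications of the Leibniz rule produce mixed terms such as
  \<open>X p f * Y p g\<close>; the commutator cancels them.\<close>

lemma lie_bracket_tangent:
  assumes sm: "smooth_structure \<A>" and X: "X \<in> vector_fields \<A>" and Y: "Y \<in> vector_fields \<A>"
  shows "lie_bracket X Y p \<in> tangent_space \<A> p"
proof -
  have T: "X q \<in> tangent_space \<A> q" "Y q \<in> tangent_space \<A> q" for q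
    using X Y by (auto simp: vector_fields_def)
  have S: "(\<lambda>q. X q f) \<in> smooth_functions \<A>" "(\<lambda>q. Y q f) \<in> smooth_functions \<A>" if "f \<in> smooth_functions \<A>" for f
    using X Y that by (auto simp: vector_fields_def)
  note rules = tangent_add_fun[OF T(1)] tangent_add_fun[OF T(2)] tangent_mult_fun[OF T(1)] tangent_mult_fun[OF T(2)]
    tangent_cmult_fun[OF T(1)] tangent_cmult_fun[OF T(2)] tangent_not_smooth[OF T(1)] tangent_not_smooth[OF T(2)]
    tangent_const[OF sm T(1)] tangent_const[OF sm T(2)]
    S smooth_functions_add[OF sm] smooth_functions_mult[OF sm] smooth_functions_cmult[OF sm]
  show ?thesis unfolding tangent_space_def lie_bracket_def
    by (simp add: rules) (simp add: algebra_simps)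
qed

lemma sum_scaleR_fun_apply:
  fixes w :: "'i \<Rightarrow> 'a \<Rightarrow> real"
  shows "(\<Sum>k\<in>I. r k *\<^sub>R w k) z = (\<Sum>k\<in>I. r k * w k z)"
  by (induction I rule: infinite_finite_induct) (simp_all add: scaleR_fun_def)

section \<open>Local frames\<close>

text \<open>A coordinate frame on the open set \<open>V\<close>, extended to global smooth functions and global vector
  fields, since tangent vectors only act on globally defined functions.\<close>

locale local_frame =
  fixes \<A> :: "('m::{t2_space, second_countable_topology}, 'n::finite) chart set"
    and U :: "'m set" and x :: "'m \<Rightarrow> real ^ 'n" and V :: "'m set"
    and g :: "'n \<Rightarrow> 'm \<Rightarrow> real" and E :: "'n \<Rightarrow> 'm \<Rightarrow> 'm tvec"
  assumes sm: "smooth_structure \<A>" and chart: "(U, x) \<in> \<A>" and V: "open V" "V \<subseteq> U"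
    and g: "g k \<in> smooth_functions \<A>" and g_eq: "q \<in> V \<Longrightarrow> g k q = x q $ k"
    and E: "E k \<in> vector_fields \<A>" and E_eq: "q \<in> V \<Longrightarrow> E k q = coord_vec \<A> (U, x) k q"

text \<open>Coordinates and coordinate fields are multiplied by the same cutoff, and
  \<open>V\<close> is a neighbourhood of \<open>p\<close> on which it equals 1.\<close>

lemma local_frame_exists:
  fixes \<A> :: "('m::{t2_space, second_countable_topology}, 'n::finite) chart set"
  assumes sm: "smooth_structure \<A>" and c: "(U, x) \<in> \<A>" and p: "p \<in> U"
  shows "\<exists>V g E. p \<in> V \<and> local_frame \<A> U x V g E"
proof -
  have ch: "is_chart (U, x)" by (rule smooth_structure_chart[OF sm c])
  then have opU: "open U" and opx: "open (x ` U)" by (simp_all add: is_chart_def)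
  obtain \<phi> V where V: "open V" "p \<in> V" "V \<subseteq> U" "\<forall>q\<in>V. \<phi> q = 1" "\<forall>q. q \<notin> U \<longrightarrow> \<phi> q = 0"
    and h: "\<And>h. smooth_on (x ` U) h \<Longrightarrow> (\<lambda>q. if q \<in> U then \<phi> q * h (x q) else 0) \<in> smooth_functions \<A>"
    using cutoff_smooth[OF sm c opU order_refl p] by blast
  define g where "g = (\<lambda>k q. if q \<in> U then \<phi> q * x q $ k else 0)"
  define E where "E = (\<lambda>k q. \<phi> q *\<^sub>R coord_vec \<A> (U, x) k q)"
  have "g k \<in> smooth_functions \<A>" for k
    unfolding g_def by (rule h[OF smooth_on_linear[OF opx bounded_linear_vec_nth]])
  moreover have "E k \<in> vector_fields \<A>" for k
  proof -
    have "E k q \<in> tangent_space \<A> q" for q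
    proof (cases "q \<in> U")
      case True
      then show ?thesis unfolding E_def by (intro tangent_space_scaleR coord_vec_tangent[OF sm c]) simp
    next
      case False
      then have "E k q = 0" using V by (simp add: E_def)
      then show ?thesis by (simp only: tangent_space_zero)
    qed
    moreover have "(\<lambda>q. E k q f) \<in> smooth_functions \<A>" if f: "f \<in> smooth_functions \<A>" for f
    proof -
      \<comment> \<open>In the chart, \<open>E k q f\<close> is the k-th partial derivative of
        \<open>f\<close> times the cutoff, so it is again a cut-off smooth function.\<close>
      have "smooth_on (x ` U) (\<lambda>y. frechet_derivative (f \<circ> chart_inv (U, x)) (at y) (axis k 1))"
        by (rule smooth_on_frechet_derivative) (use smooth_functionsD[OF f c] in \<open>simp add: comp_def\<close>)
      from h[OF this] show ?thesis
        by (rule back_subst[of "\<lambda>f. f \<in> smooth_functions \<A>"])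
          (use V(5) in \<open>auto simp: E_def scaleR_fun_def coord_vec_def partial_def f fun_eq_iff\<close>)
    qed
    ultimately show ?thesis by (simp add: vector_fields_def)
  qed
  ultimately have "local_frame \<A> U x V g E"
    using sm c V by unfold_locales (auto simp: g_def E_def)
  then show ?thesis using V by blast
qed

section \<open>Expansion of vectors and covectors in the frame\<close>

context local_frame
begin

abbreviation "pd \<equiv> partial (U, x)"
abbreviation "F \<equiv> smooth_functions \<A>"

lemma ch: "is_chart (U, x)"
  by (rule smooth_structure_chart[OF sm chart])

lemma chart_inv_V: "q \<in> V \<Longrightarrow> chart_inv (U, x) (x q) = q"
  using chart_inv_chart[OF ch, of q] V by auto

lemma frame_tangent: "q \<in> V \<Longrightarrow> coord_vec \<A> (U, x) k q \<in> tangent_space \<A> q"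
  using coord_vec_tangent[OF sm chart] V by auto

lemma coord_vec_apply: "f \<in> F \<Longrightarrow> coord_vec \<A> (U, x) k q f = pd k f q"
  by (simp add: coord_vec_def)

lemma partial_local:
  assumes "q \<in> V" "\<And>z. z \<in> V \<Longrightarrow> f z = h z"
  shows "pd k f q = pd k h q"
  by (rule partial_cong[OF ch V(1) assms(1)]) (use assms V in auto)

lemma partial_coord:
  assumes "q \<in> V"
  shows "pd k (g l) q = (if l = k then 1 else 0)"
proof -
  have "open (x ` V)" using chart_open_image[OF ch V(1)] V(2) by simp
  then have "frechet_derivative (g l \<circ> chart_inv (U, x)) (at (x q)) = frechet_derivative (\<lambda>y. y $ l) (at (x q))"
    by (rule frechet_derivative_cong_open) (use assms V chart_inv_chart[OF ch] g_eq in auto)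
  also have "\<dots> = (\<lambda>y. y $ l)"
    by (rule frechet_derivative_at[OF bounded_linear_imp_has_derivative[OF bounded_linear_vec_nth], symmetric])
  finally show ?thesis by (simp add: partial_def axis_def)
qed

text \<open>By Hadamard's lemma f = f(q) + sum of (g_i - g_i(q)) H_i near \<open>q\<close>, with
  H_i(q) the i-th partial derivative. A derivation kills the constant, and because g_i - g_i(q)
  vanishes at \<open>q\<close>, the Leibniz rule leaves v(g_i) H_i(q).\<close>

lemma tangent_expansion_apply:
  assumes q: "q \<in> V" and v: "v \<in> tangent_space \<A> q" and f: "f \<in> F"
  shows "v f = (\<Sum>k\<in>UNIV. v (g k) * pd k f q)"
proof -
  have "open (x ` V)" using chart_open_image[OF ch V(1)] V(2) by simp
  then obtain r where r: "r > 0" "ball (x q) r \<subseteq> x ` V" using q open_contains_ball by blast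
  have xVU: "x ` V \<subseteq> x ` U" using V by auto
  \<comment> \<open>Hadamard's lemma needs a ball, so \<open>V\<close> is shrunk to the preimage of
    a ball inside its image.\<close>
  define W where "W = {z \<in> V. x z \<in> ball (x q) r}"
  have W: "open W" "W \<subseteq> U" "q \<in> W" "W \<subseteq> V"
    using chart_open_preimage[OF ch V(1), of "ball (x q) r"] V q r by (auto simp: W_def)
  have xW: "x ` W = ball (x q) r" using r by (auto simp: W_def)
  let ?f = "f \<circ> chart_inv (U, x)"
  have "smooth_on (ball (x q) r) ?f"
    using smooth_on_subset[OF smooth_functionsD[OF f chart], of "ball (x q) r"] r xVU by (simp add: comp_def)
  from hadamard[OF this r(1)] obtain h where
    h: "\<And>i. smooth_on (ball (x q) r) (h i)" "\<And>i. h i (x q) = pd i f q"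
      "\<And>y. y \<in> ball (x q) r \<Longrightarrow> ?f y = ?f (x q) + (\<Sum>i\<in>UNIV. (y $ i - x q $ i) * h i y)"
    unfolding partial_def snd_conv by blast
  from cutoff_smooth[OF sm chart W(1-3)] obtain \<phi> N where
    N: "open N" "q \<in> N" "N \<subseteq> W" "\<forall>z\<in>N. \<phi> z = 1"
    and cut: "\<And>h. smooth_on (x ` W) h \<Longrightarrow> (\<lambda>z. if z \<in> W then \<phi> z * h (x z) else 0) \<in> F"
    by blast
  \<comment> \<open>The Hadamard coefficients exist only in the chart; cut off, they enter functions
    on which \<open>v\<close> acts, and they are unchanged near \<open>q\<close>.\<close>
  define H where "H = (\<lambda>i z. if z \<in> W then \<phi> z * h i (x z) else 0)"
  have H: "H i \<in> F" for i unfolding H_def by (rule cut) (simp add: xW h)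
  have Hq: "H i q = pd i f q" for i using N W h(2) by (simp add: H_def)
  have G: "(\<lambda>z. g i z - g i q) \<in> F" for i
    by (intro smooth_functions_diff[OF sm g] smooth_functions_const[OF sm])
  have P: "(\<lambda>z. (g i z - g i q) * H i z) \<in> F" for i by (intro smooth_functions_mult[OF sm G H])
  have "v f = v (\<lambda>z. f q + (\<Sum>i\<in>UNIV. (g i z - g i q) * H i z))"
  proof (rule tangent_local[OF sm v f _ N(1,2)])
    show "(\<lambda>z. f q + (\<Sum>i\<in>UNIV. (g i z - g i q) * H i z)) \<in> F"
      by (intro smooth_functions_add[OF sm] smooth_functions_const[OF sm] smooth_functions_sum[OF sm] P)
    fix z assume "z \<in> N"
    then have z: "z \<in> W" "z \<in> V" "\<phi> z = 1" "x z \<in> ball (x q) r" using N W by (auto simp: W_def)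
    then show "f z = f q + (\<Sum>i\<in>UNIV. (g i z - g i q) * H i z)"
      using h(3)[of "x z"] q by (simp add: H_def g_eq chart_inv_V)
  qed
  also have "\<dots> = (\<Sum>i\<in>UNIV. v (\<lambda>z. (g i z - g i q) * H i z))"
    by (simp add: tangent_add_fun[OF v smooth_functions_const[OF sm]] smooth_functions_sum[OF sm] P
        tangent_sum_fun[OF sm v] tangent_const[OF sm v])
  also have "\<dots> = (\<Sum>i\<in>UNIV. v (g i) * pd i f q)"
    using tangent_mult_fun[OF v G H] tangent_diff_fun[OF sm v g smooth_functions_const[OF sm]]
      tangent_const[OF sm v] by (simp add: Hq)
  finally show ?thesis .
qed

lemma tangent_expansion:
  assumes "q \<in> V" "v \<in> tangent_space \<A> q"
  shows "v = (\<Sum>k\<in>UNIV. v (g k) *\<^sub>R coord_vec \<A> (U, x) k q)"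
proof
  fix f
  show "v f = (\<Sum>k\<in>UNIV. v (g k) *\<^sub>R coord_vec \<A> (U, x) k q) f"
    unfolding sum_scaleR_fun_apply using tangent_expansion_apply[OF assms] tangent_not_smooth[OF assms(2)]
    by (cases "f \<in> F") (simp_all add: coord_vec_def)
qed

lemma cotangent_expansion:
  assumes "q \<in> V" "\<omega> \<in> cotangent_space \<A> q" "v \<in> tangent_space \<A> q"
  shows "\<omega> v = (\<Sum>k\<in>UNIV. v (g k) * \<omega> (coord_vec \<A> (U, x) k q))"
  by (rule trans[OF arg_cong[OF tangent_expansion[OF assms(1,3)], of \<omega>]
        cotangent_sum[OF assms(2) frame_tangent[OF assms(1)]]])

section \<open>Lie derivative and exterior derivative in coordinates\<close>

lemma vector_field_tangent: "X \<in> vector_fields \<A> \<Longrightarrow> X q \<in> tangent_space \<A> q"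
  by (simp add: vector_fields_def)

lemma vector_field_smooth: "X \<in> vector_fields \<A> \<Longrightarrow> f \<in> F \<Longrightarrow> (\<lambda>q. X q f) \<in> F"
  by (simp add: vector_fields_def)

lemma one_form_cotangent: "\<eta> \<in> one_forms \<A> \<Longrightarrow> \<eta> q \<in> cotangent_space \<A> q"
  by (simp add: one_forms_def)

lemma one_form_smooth: "\<eta> \<in> one_forms \<A> \<Longrightarrow> X \<in> vector_fields \<A> \<Longrightarrow> (\<lambda>q. \<eta> q (X q)) \<in> F"
  by (simp add: one_forms_def)

text \<open>The product rule for the local expression of \<eta>(Z) as the sum of Z^k \<eta>_k. It
  separates the derivatives of \<open>Z\<close> from those of \<open>\<eta>\<close>, so that the
  former can be cancelled against a bracket term when \<open>Z\<close> is an arbitrary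
  extension.\<close>

lemma tangent_pairing:
  assumes p: "p \<in> V" and v: "v \<in> tangent_space \<A> p" and \<eta>: "\<eta> \<in> one_forms \<A>" and Z: "Z \<in> vector_fields \<A>"
  shows "v (\<lambda>q. \<eta> q (Z q)) =
    (\<Sum>k\<in>UNIV. v (\<lambda>q. Z q (g k)) * \<eta> p (E k p) + Z p (g k) * v (\<lambda>q. \<eta> q (E k q)))"
proof -
  have P: "(\<lambda>q. Z q (g k) * \<eta> q (E k q)) \<in> F" for k
    by (rule smooth_functions_mult[OF sm vector_field_smooth[OF Z g] one_form_smooth[OF \<eta> E]])
  have "v (\<lambda>q. \<eta> q (Z q)) = v (\<lambda>q. \<Sum>k\<in>UNIV. Z q (g k) * \<eta> q (E k q))"
  proof (rule tangent_local[OF sm v _ _ V(1) p])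
    show "(\<lambda>q. \<eta> q (Z q)) \<in> F" by (rule one_form_smooth[OF \<eta> Z])
    show "(\<lambda>q. \<Sum>k\<in>UNIV. Z q (g k) * \<eta> q (E k q)) \<in> F" by (rule smooth_functions_sum[OF sm P])
    fix q assume "q \<in> V"
    then show "\<eta> q (Z q) = (\<Sum>k\<in>UNIV. Z q (g k) * \<eta> q (E k q))"
      using cotangent_expansion[OF _ one_form_cotangent[OF \<eta>] vector_field_tangent[OF Z], of q] by (simp add: E_eq)
  qed
  also have "\<dots> = (\<Sum>k\<in>UNIV. v (\<lambda>q. Z q (g k) * \<eta> q (E k q)))"
    by (rule tangent_sum_fun[OF sm v P])
  also have "\<dots> = (\<Sum>k\<in>UNIV. v (\<lambda>q. Z q (g k)) * \<eta> p (E k p) + Z p (g k) * v (\<lambda>q. \<eta> q (E k q)))"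
    by (intro sum.cong refl tangent_mult_fun[OF v vector_field_smooth[OF Z g] one_form_smooth[OF \<eta> E]])
  finally show ?thesis .
qed

lemma one_form_lie_bracket:
  assumes p: "p \<in> V" and \<eta>: "\<eta> \<in> one_forms \<A>" and X: "X \<in> vector_fields \<A>" and Z: "Z \<in> vector_fields \<A>"
  shows "\<eta> p (lie_bracket X Z p) =
    (\<Sum>k\<in>UNIV. (X p (\<lambda>q. Z q (g k)) - Z p (\<lambda>q. X q (g k))) * \<eta> p (E k p))"
  using cotangent_expansion[OF p one_form_cotangent[OF \<eta>] lie_bracket_tangent[OF sm X Z]]
  by (simp add: lie_bracket_def E_eq[OF p])

text \<open>For a vector given as the value of a field \<open>Z\<close>, the field itself witnesses
  that the choice in \<open>extend_vec\<close> succeeds. Of the chosen field only the value at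
  \<open>p\<close> is known.\<close>

lemma extend_vec:
  assumes "Z \<in> vector_fields \<A>"
  shows "extend_vec \<A> p (Z p) \<in> vector_fields \<A>" "extend_vec \<A> p (Z p) p = Z p"
proof -
  have "extend_vec \<A> p (Z p) \<in> vector_fields \<A> \<and> extend_vec \<A> p (Z p) p = Z p"
    unfolding extend_vec_def by (rule someI[where x = Z]) (simp add: assms)
  then show "extend_vec \<A> p (Z p) \<in> vector_fields \<A>" "extend_vec \<A> p (Z p) p = Z p" by auto
qed

lemma frame_apply_coord: "p \<in> V \<Longrightarrow> E l p (g k) = (if k = l then 1 else 0)"
  by (simp add: E_eq coord_vec_apply[OF g] partial_coord)

lemma frame_apply: "p \<in> V \<Longrightarrow> f \<in> F \<Longrightarrow> E l p f = pd l f p"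
  by (simp add: E_eq coord_vec_apply)

text \<open>The terms X(Z^k) \<eta>_k occur both in X(\<eta>(Z)) and in \<eta>([X, Z]) and cancel.
  What is left depends on the extension \<open>Z\<close> only through \<open>Z p\<close>.\<close>

lemma lie_deriv_form_coord:
  assumes p: "p \<in> V" and X: "X \<in> vector_fields \<A>" and \<eta>: "\<eta> \<in> one_forms \<A>"
  shows "lie_deriv_form \<A> X \<eta> p (E l p) =
    (\<Sum>k\<in>UNIV. X p (g k) * pd k (\<lambda>q. \<eta> q (E l q)) p + \<eta> p (E k p) * pd l (\<lambda>q. X q (g k)) p)"
proof -
  define Z where "Z = extend_vec \<A> p (E l p)"
  have Z: "Z \<in> vector_fields \<A>" "Z p = E l p" unfolding Z_def by (rule extend_vec[OF E])+
  have "lie_deriv_form \<A> X \<eta> p (E l p) = X p (\<lambda>q. \<eta> q (Z q)) - \<eta> p (lie_bracket X Z p)"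
    using vector_field_tangent[OF E] by (simp add: lie_deriv_form_def Z_def Let_def)
  also have "\<dots> = (\<Sum>k\<in>UNIV. Z p (g k) * X p (\<lambda>q. \<eta> q (E k q)) + Z p (\<lambda>q. X q (g k)) * \<eta> p (E k p))"
    unfolding tangent_pairing[OF p vector_field_tangent[OF X] \<eta> Z(1)] one_form_lie_bracket[OF p \<eta> X Z(1)]
    by (simp add: sum_subtractf[symmetric] algebra_simps)
  also have "\<dots> = X p (\<lambda>q. \<eta> q (E l q)) + (\<Sum>k\<in>UNIV. \<eta> p (E k p) * pd l (\<lambda>q. X q (g k)) p)"
    by (simp add: Z(2) frame_apply_coord[OF p] frame_apply[OF p vector_field_smooth[OF X g]] sum.distrib
        if_distrib[of "\<lambda>r. r * _"] mult.commute cong: if_cong)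
  also have "X p (\<lambda>q. \<eta> q (E l q)) = (\<Sum>k\<in>UNIV. X p (g k) * pd k (\<lambda>q. \<eta> q (E l q)) p)"
    by (rule tangent_expansion_apply[OF p vector_field_tangent[OF X] one_form_smooth[OF \<eta> E]])
  finally show ?thesis by (simp add: sum.distrib)
qed

text \<open>The derivatives of the components of both extensions occur in the pairings and, with
  opposite sign, in the bracket term, so only the values at \<open>p\<close> remain.\<close>

lemma ext_deriv_coord:
  assumes p: "p \<in> V" and Y: "Y \<in> vector_fields \<A>" and \<xi>: "\<xi> \<in> one_forms \<A>"
  shows "ext_deriv \<A> \<xi> p (Y p) (E l p) =
    (\<Sum>k\<in>UNIV. Y p (g k) * (pd k (\<lambda>q. \<xi> q (E l q)) p - pd l (\<lambda>q. \<xi> q (E k q)) p))"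
proof -
  define T where "T = extend_vec \<A> p (Y p)"
  define W where "W = extend_vec \<A> p (E l p)"
  have T: "T \<in> vector_fields \<A>" "T p = Y p" unfolding T_def by (rule extend_vec[OF Y])+
  have W: "W \<in> vector_fields \<A>" "W p = E l p" unfolding W_def by (rule extend_vec[OF E])+
  have "ext_deriv \<A> \<xi> p (Y p) (E l p) =
      T p (\<lambda>q. \<xi> q (W q)) - W p (\<lambda>q. \<xi> q (T q)) - \<xi> p (lie_bracket T W p)"
    using vector_field_tangent[OF E] vector_field_tangent[OF Y] T(2) W(2)
    by (simp add: ext_deriv_def T_def W_def Let_def)
  also have "\<dots> = (\<Sum>k\<in>UNIV. W p (g k) * T p (\<lambda>q. \<xi> q (E k q)) - T p (g k) * W p (\<lambda>q. \<xi> q (E k q)))"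
    unfolding tangent_pairing[OF p vector_field_tangent[OF T(1)] \<xi> W(1)]
      tangent_pairing[OF p vector_field_tangent[OF W(1)] \<xi> T(1)] one_form_lie_bracket[OF p \<xi> T(1) W(1)]
    by (simp add: sum_subtractf[symmetric] algebra_simps)
  also have "\<dots> = T p (\<lambda>q. \<xi> q (E l q)) - (\<Sum>k\<in>UNIV. T p (g k) * pd l (\<lambda>q. \<xi> q (E k q)) p)"
    by (simp add: W(2) frame_apply_coord[OF p] frame_apply[OF p one_form_smooth[OF \<xi> E]] sum_subtractf
        if_distrib[of "\<lambda>r. r * _"] cong: if_cong)
  also have "T p (\<lambda>q. \<xi> q (E l q)) = (\<Sum>k\<in>UNIV. T p (g k) * pd k (\<lambda>q. \<xi> q (E l q)) p)"
    by (rule tangent_expansion_apply[OF p vector_field_tangent[OF T(1)] one_form_smooth[OF \<xi> E]])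
  finally show ?thesis by (simp add: T(2) sum_subtractf right_diff_distrib)
qed

section \<open>The Dorfman bracket in components\<close>

definition bracket_vec :: "'m \<Rightarrow> ('n \<Rightarrow> 'm \<Rightarrow> real) \<Rightarrow> ('n \<Rightarrow> 'm \<Rightarrow> real) \<Rightarrow> 'n \<Rightarrow> real" where
  "bracket_vec p X Y l = (\<Sum>k\<in>UNIV. X k p * pd k (Y l) p - Y k p * pd k (X l) p)"

text \<open>The first two summands are the Lie derivative of \<open>\<eta>\<close> along
  \<open>X\<close>, the last is minus the contraction of d\<xi> with \<open>Y\<close>.\<close>

definition bracket_form ::
    "'m \<Rightarrow> ('n \<Rightarrow> 'm \<Rightarrow> real) \<Rightarrow> ('n \<Rightarrow> 'm \<Rightarrow> real) \<Rightarrow> ('n \<Rightarrow> 'm \<Rightarrow> real) \<Rightarrow> ('n \<Rightarrow> 'm \<Rightarrow> real) \<Rightarrow> 'n \<Rightarrow> real"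
  where
  "bracket_form p X \<xi> Y \<eta> l = (\<Sum>k\<in>UNIV. X k p * pd k (\<eta> l) p + \<eta> k p * pd l (X k) p
     - Y k p * (pd k (\<xi> l) p - pd l (\<xi> k) p))"

text \<open>Prescribing the component functions on \<open>V\<close> alone lets the matrix entries
  serve as components; as \<open>V\<close> is open, their partial derivatives there are those of
  globally smooth functions.\<close>

definition has_components ::
    "('m \<Rightarrow> 'm gvec) \<Rightarrow> ('n \<Rightarrow> 'm \<Rightarrow> real) \<Rightarrow> ('n \<Rightarrow> 'm \<Rightarrow> real) \<Rightarrow> bool" where
  "has_components u X \<xi> \<longleftrightarrow> u \<in> sec (gen_tangent_bundle \<A>) \<and>
     (\<forall>q\<in>V. \<forall>k. fst (u q) (g k) = X k q \<and> snd (u q) (E k q) = \<xi> k q)"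

lemma gen_section:
  "u \<in> sec (gen_tangent_bundle \<A>) \<longleftrightarrow> (\<lambda>q. fst (u q)) \<in> vector_fields \<A> \<and> (\<lambda>q. snd (u q)) \<in> one_forms \<A>"
  by (simp add: gen_tangent_bundle_def direct_sum_def tangent_bundle_def cotangent_bundle_def)

lemma gen_fibre:
  "s \<in> fib (gen_tangent_bundle \<A>) p \<longleftrightarrow> fst s \<in> tangent_space \<A> p \<and> snd s \<in> cotangent_space \<A> p"
  by (cases s) (simp add: gen_tangent_bundle_def direct_sum_def tangent_bundle_def cotangent_bundle_def)

lemma partial_components:
  assumes "has_components u X \<xi>" "p \<in> V"
  shows "pd k (\<lambda>q. fst (u q) (g l)) p = pd k (X l) p" "pd k (\<lambda>q. snd (u q) (E l q)) p = pd k (\<xi> l) p"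
  using assms by (auto simp: has_components_def intro!: partial_local)

lemma dorfman_components:
  assumes u: "has_components u X \<xi>" and w: "has_components w Y \<eta>" and p: "p \<in> V"
  shows "fst (dorfman \<A> u w p) (g l) = bracket_vec p X Y l"
    and "snd (dorfman \<A> u w p) (E l p) = bracket_form p X \<xi> Y \<eta> l"
proof -
  have S: "(\<lambda>q. fst (u q)) \<in> vector_fields \<A>" "(\<lambda>q. snd (u q)) \<in> one_forms \<A>"
    "(\<lambda>q. fst (w q)) \<in> vector_fields \<A>" "(\<lambda>q. snd (w q)) \<in> one_forms \<A>"
    using u w by (auto simp: has_components_def gen_section)
  have C: "fst (u p) (g k) = X k p" "snd (u p) (E k p) = \<xi> k p"
    "fst (w p) (g k) = Y k p" "snd (w p) (E k p) = \<eta> k p" for k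
    using u w p by (auto simp: has_components_def)
  show "fst (dorfman \<A> u w p) (g l) = bracket_vec p X Y l"
    using tangent_expansion_apply[OF p vector_field_tangent[OF S(1)] vector_field_smooth[OF S(3) g[of l]]]
      tangent_expansion_apply[OF p vector_field_tangent[OF S(3)] vector_field_smooth[OF S(1) g[of l]]]
    by (simp add: dorfman_def Let_def lie_bracket_def bracket_vec_def C partial_components[OF u p]
        partial_components[OF w p] sum_subtractf)
  show "snd (dorfman \<A> u w p) (E l p) = bracket_form p X \<xi> Y \<eta> l"
    using lie_deriv_form_coord[OF p S(1,4), of l] ext_deriv_coord[OF p S(3,2), of l]
    by (simp add: dorfman_def Let_def interior_prod_def bracket_form_def C partial_components[OF u p]
        partial_components[OF w p] sum_subtractf)
qed

end

section \<open>Weak generalized complex structures in coordinates\<close>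

text \<open>A \<open>vbundle\<close> record does not say that its fibres are subspaces, so closure
  is supplied here. The induction carries membership of the partial sum along, since additivity is
  available only inside the fibre.\<close>

lemma bundle_morphism_sum:
  assumes \<Phi>: "bundle_morphism E F \<Phi>" and "0 \<in> fib E p"
    and "\<And>s t. s \<in> fib E p \<Longrightarrow> t \<in> fib E p \<Longrightarrow> s + t \<in> fib E p"
    and sc: "\<And>r s. s \<in> fib E p \<Longrightarrow> r *\<^sub>R s \<in> fib E p"
    and s: "\<And>k. k \<in> I \<Longrightarrow> s k \<in> fib E p"
  shows "\<Phi> p (\<Sum>k\<in>I. r k *\<^sub>R s k) = (\<Sum>k\<in>I. r k *\<^sub>R \<Phi> p (s k))"
proof -
  have add: "\<Phi> p (s + t) = \<Phi> p s + \<Phi> p t" if "s \<in> fib E p" "t \<in> fib E p" for s t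
    using \<Phi> that unfolding bundle_morphism_def by blast
  have scale: "\<Phi> p (r *\<^sub>R s) = r *\<^sub>R \<Phi> p s" if "s \<in> fib E p" for r s
    using \<Phi> that unfolding bundle_morphism_def by blast
  have zero: "\<Phi> p 0 = 0" using scale[OF assms(2), of 0] by (simp only: scale_zero_left)
  have "(\<Sum>k\<in>I. r k *\<^sub>R s k) \<in> fib E p \<and> \<Phi> p (\<Sum>k\<in>I. r k *\<^sub>R s k) = (\<Sum>k\<in>I. r k *\<^sub>R \<Phi> p (s k))"
    using s
  proof (induction I rule: infinite_finite_induct)
    case (insert i I)
    then have IH: "(\<Sum>k\<in>I. r k *\<^sub>R s k) \<in> fib E p"
      "\<Phi> p (\<Sum>k\<in>I. r k *\<^sub>R s k) = (\<Sum>k\<in>I. r k *\<^sub>R \<Phi> p (s k))" and i: "s i \<in> fib E p" by blast+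
    show ?case unfolding sum.insert[OF insert.hyps]
      using assms(3)[OF sc[OF i] IH(1)] add[OF sc[OF i] IH(1)] scale[OF i] IH(2) by (simp only: simp_thms)
  qed (simp_all only: sum.infinite sum.empty assms(2) zero simp_thms)
  then show ?thesis by blast
qed

section \<open>Cotangent spaces and the dual frame\<close>

lemma cotangent_space_zero: "0 \<in> cotangent_space \<A> p"
  by (simp add: cotangent_space_def)

lemma cotangent_space_add:
  "\<omega> \<in> cotangent_space \<A> p \<Longrightarrow> \<eta> \<in> cotangent_space \<A> p \<Longrightarrow> \<omega> + \<eta> \<in> cotangent_space \<A> p"
  unfolding cotangent_space_def[of \<A> p] mem_Collect_eq
  by (intro conjI ballI allI impI)
    (simp_all add: cotangent_add cotangent_scaleR cotangent_not_tangent algebra_simps)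

lemma cotangent_space_scaleR:
  "\<omega> \<in> cotangent_space \<A> p \<Longrightarrow> r *\<^sub>R \<omega> \<in> cotangent_space \<A> p"
  unfolding cotangent_space_def[of \<A> p] mem_Collect_eq
  by (intro conjI ballI allI impI)
    (simp_all add: cotangent_add cotangent_scaleR cotangent_not_tangent scaleR_fun_def algebra_simps)

lemma tangent_morphism_sum:
  assumes "bundle_morphism (tangent_bundle \<A>) F \<Phi>" "\<And>k. k \<in> I \<Longrightarrow> v k \<in> tangent_space \<A> p"
  shows "\<Phi> p (\<Sum>k\<in>I. r k *\<^sub>R v k) = (\<Sum>k\<in>I. r k *\<^sub>R \<Phi> p (v k))"
  by (rule bundle_morphism_sum[OF assms(1)])
    (simp_all only: tangent_bundle_def vbundle.simps tangent_space_zero tangent_space_add tangent_space_scaleR assms(2))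

lemma cotangent_morphism_sum:
  assumes "bundle_morphism (cotangent_bundle \<A>) F \<Phi>" "\<And>k. k \<in> I \<Longrightarrow> \<omega> k \<in> cotangent_space \<A> p"
  shows "\<Phi> p (\<Sum>k\<in>I. r k *\<^sub>R \<omega> k) = (\<Sum>k\<in>I. r k *\<^sub>R \<Phi> p (\<omega> k))"
  by (rule bundle_morphism_sum[OF assms(1)])
    (simp_all only: cotangent_bundle_def vbundle.simps cotangent_space_zero cotangent_space_add cotangent_space_scaleR assms(2))

context local_frame
begin

text \<open>\<open>G k\<close> is the differential of \<open>g k\<close>, a global 1-form that equals \<open>dx\<^sup>k\<close> on \<open>V\<close>.\<close>

definition G :: "'n \<Rightarrow> 'm \<Rightarrow> 'm covec" where
  "G k q = (\<lambda>v. if v \<in> tangent_space \<A> q then v (g k) else 0)"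

lemma G_cotangent: "G k q \<in> cotangent_space \<A> q"
  unfolding cotangent_space_def mem_Collect_eq
proof (intro conjI ballI allI impI)
  fix r v assume "v \<in> tangent_space \<A> q"
  then show "G k q (r *\<^sub>R v) = r * G k q v"
    unfolding G_def using tangent_space_scaleR[of v \<A> q r] by (simp only: if_True) (simp add: scaleR_fun_def)
qed (simp_all only: G_def tangent_space_add if_True if_False plus_fun_apply)

lemma G_one_form: "G k \<in> one_forms \<A>"
  by (simp add: one_forms_def G_cotangent) (simp add: G_def vector_field_tangent vector_field_smooth g)

text \<open>\<open>differential\<close> chooses some global function with the germ of the k-th
  coordinate. \<open>g k\<close> shows that one exists, and derivations depend only on the
  germ.\<close>

lemma coord_form_eq:
  assumes q: "q \<in> V"
  shows "coord_form \<A> (U, x) k q = G k q"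
proof -
  define f where "f = (SOME f. f \<in> F \<and> (\<exists>N. open N \<and> q \<in> N \<and> (\<forall>z\<in>N. f z = x z $ k)))"
  have "f \<in> F \<and> (\<exists>N. open N \<and> q \<in> N \<and> (\<forall>z\<in>N. f z = x z $ k))"
    unfolding f_def by (rule someI[where x = "g k"]) (use g V q g_eq in blast)
  then obtain N where f: "f \<in> F" and N: "open N" "q \<in> N" "\<forall>z\<in>N. f z = x z $ k" by blast
  have "v f = v (g k)" if "v \<in> tangent_space \<A> q" for v
    by (rule tangent_local[OF sm that f g, of "N \<inter> V"]) (use N V q g_eq in auto)
  then show ?thesis
    by (simp add: coord_form_def differential_def G_def f_def fun_eq_iff)
qed

lemma covector_expansion:
  assumes q: "q \<in> V" and \<omega>: "\<omega> \<in> cotangent_space \<A> q"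
  shows "\<omega> = (\<Sum>k\<in>UNIV. \<omega> (E k q) *\<^sub>R G k q)"
proof
  fix v
  show "\<omega> v = (\<Sum>k\<in>UNIV. \<omega> (E k q) *\<^sub>R G k q) v"
    unfolding sum_scaleR_fun_apply
    using cotangent_expansion[OF q \<omega>, of v] cotangent_not_tangent[OF \<omega>, of v]
    by (cases "v \<in> tangent_space \<A> q") (simp_all add: G_def E_eq[OF q] mult.commute)
qed

lemma G_frame: "q \<in> V \<Longrightarrow> G k q (E l q) = (if k = l then 1 else 0)"
  by (simp add: G_def vector_field_tangent[OF E] frame_apply_coord)

end

text \<open>The matrix entries are taken with respect to the global objects \<open>E\<close> and
  \<open>G\<close>, so that \<J> can be applied to genuine sections; on \<open>V\<close> this frame
  is the coordinate one.\<close>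

locale gen_structure_in_frame = local_frame \<A> U x V g E
  for \<A> :: "('m::{t2_space, second_countable_topology}, 'n::finite) chart set"
    and U x V g E +
  fixes \<J> :: "'m \<Rightarrow> 'm gvec \<Rightarrow> 'm gvec"
    and A :: "'m \<Rightarrow> 'm tvec \<Rightarrow> 'm tvec"
    and B :: "'m \<Rightarrow> 'm covec \<Rightarrow> 'm tvec"
    and C :: "'m \<Rightarrow> 'm tvec \<Rightarrow> 'm covec"
    and D :: "'m \<Rightarrow> 'm covec \<Rightarrow> 'm covec"
    and a b c d :: "'n \<Rightarrow> 'n \<Rightarrow> 'm \<Rightarrow> real"
  assumes \<J>: "weak_gen_almost_complex \<A> \<J>"
    and A: "bundle_morphism (tangent_bundle \<A>) (tangent_bundle \<A>) A"
    and B: "bundle_morphism (cotangent_bundle \<A>) (tangent_bundle \<A>) B"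
    and C: "bundle_morphism (tangent_bundle \<A>) (cotangent_bundle \<A>) C"
    and D: "bundle_morphism (cotangent_bundle \<A>) (cotangent_bundle \<A>) D"
    and block: "\<And>p X \<xi>. X \<in> tangent_space \<A> p \<Longrightarrow> \<xi> \<in> cotangent_space \<A> p \<Longrightarrow>
           \<J> p (X, \<xi>) = (A p X + B p \<xi>, C p X + D p \<xi>)"
    and a: "\<And>p i. p \<in> V \<Longrightarrow> A p (E i p) = (\<Sum>j\<in>UNIV. a i j p *\<^sub>R E j p)"
    and b: "\<And>p i. p \<in> V \<Longrightarrow> B p (G i p) = (\<Sum>j\<in>UNIV. b i j p *\<^sub>R E j p)"
    and c: "\<And>p i. p \<in> V \<Longrightarrow> C p (E i p) = (\<Sum>j\<in>UNIV. c i j p *\<^sub>R G j p)"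
    and d: "\<And>p i. p \<in> V \<Longrightarrow> D p (G i p) = (\<Sum>j\<in>UNIV. d i j p *\<^sub>R G j p)"
    and integrable: "integrable_gen \<A> \<J>"
begin

section \<open>The structure and its sections in components\<close>

lemma J_components:
  assumes q: "q \<in> V" and s: "s \<in> fib (gen_tangent_bundle \<A>) q"
  shows "fst (\<J> q s) (g l) = (\<Sum>k\<in>UNIV. fst s (g k) * a k l q + snd s (E k q) * b k l q)" (is ?v)
    and "snd (\<J> q s) (E l q) = (\<Sum>k\<in>UNIV. fst s (g k) * c k l q + snd s (E k q) * d k l q)" (is ?f)
proof -
  obtain v \<omega> where s_eq: "s = (v, \<omega>)" by (cases s)
  have v: "v \<in> tangent_space \<A> q" and \<omega>: "\<omega> \<in> cotangent_space \<A> q"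
    using s by (simp_all add: gen_fibre s_eq)
  have v_exp: "v = (\<Sum>k\<in>UNIV. v (g k) *\<^sub>R E k q)"
    using tangent_expansion[OF q v] by (simp only: E_eq[OF q])
  note \<omega>_exp = covector_expansion[OF q \<omega>]
  have Av: "A q v = (\<Sum>k\<in>UNIV. v (g k) *\<^sub>R A q (E k q))"
    by (rule trans[OF arg_cong[OF v_exp, of "A q"] tangent_morphism_sum[OF A vector_field_tangent[OF E]]])
  have Cv: "C q v = (\<Sum>k\<in>UNIV. v (g k) *\<^sub>R C q (E k q))"
    by (rule trans[OF arg_cong[OF v_exp, of "C q"] tangent_morphism_sum[OF C vector_field_tangent[OF E]]])
  have B\<omega>: "B q \<omega> = (\<Sum>k\<in>UNIV. \<omega> (E k q) *\<^sub>R B q (G k q))"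
    by (rule trans[OF arg_cong[OF \<omega>_exp, of "B q"] cotangent_morphism_sum[OF B G_cotangent]])
  have D\<omega>: "D q \<omega> = (\<Sum>k\<in>UNIV. \<omega> (E k q) *\<^sub>R D q (G k q))"
    by (rule trans[OF arg_cong[OF \<omega>_exp, of "D q"] cotangent_morphism_sum[OF D G_cotangent]])
  show ?v
    by (simp add: s_eq block[OF v \<omega>] Av B\<omega> sum_scaleR_fun_apply a[OF q] b[OF q] frame_apply_coord[OF q] sum.distrib
        if_distrib[of "\<lambda>r. _ * r"] cong: if_cong)
  show ?f
    by (simp add: s_eq block[OF v \<omega>] Cv D\<omega> sum_scaleR_fun_apply c[OF q] d[OF q] G_frame[OF q] sum.distrib
        if_distrib[of "\<lambda>r. _ * r"] cong: if_cong)
qed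

lemma J_section:
  "u \<in> sec (gen_tangent_bundle \<A>) \<Longrightarrow> (\<lambda>q. \<J> q (u q)) \<in> sec (gen_tangent_bundle \<A>)"
  using \<J> unfolding weak_gen_almost_complex_def bundle_morphism_def by blast

lemma J_has_components:
  assumes "has_components u X \<xi>"
  shows "has_components (\<lambda>q. \<J> q (u q)) (\<lambda>l q. \<Sum>k\<in>UNIV. X k q * a k l q + \<xi> k q * b k l q)
    (\<lambda>l q. \<Sum>k\<in>UNIV. X k q * c k l q + \<xi> k q * d k l q)"
proof -
  have u: "u \<in> sec (gen_tangent_bundle \<A>)" and comp: "\<And>q k. q \<in> V \<Longrightarrow> fst (u q) (g k) = X k q"
    "\<And>q k. q \<in> V \<Longrightarrow> snd (u q) (E k q) = \<xi> k q"
    using assms by (auto simp: has_components_def)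
  have "u q \<in> fib (gen_tangent_bundle \<A>) q" for q
    using u unfolding gen_section gen_fibre by (auto simp: vector_fields_def one_forms_def)
  then show ?thesis
    unfolding has_components_def using J_section[OF u] J_components by (simp add: comp)
qed

lemma J_J: "s \<in> fib (gen_tangent_bundle \<A>) q \<Longrightarrow> \<J> q (\<J> q s) = - s"
  using \<J> unfolding weak_gen_almost_complex_def by blast

lemma J_fibre: "s \<in> fib (gen_tangent_bundle \<A>) q \<Longrightarrow> \<J> q s \<in> fib (gen_tangent_bundle \<A>) q"
  using \<J> unfolding weak_gen_almost_complex_def bundle_morphism_def by blast

lemma section_fibre: "u \<in> sec (gen_tangent_bundle \<A>) \<Longrightarrow> u q \<in> fib (gen_tangent_bundle \<A>) q"
  unfolding gen_section gen_fibre by (auto simp: vector_fields_def one_forms_def)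

lemma minus_has_components:
  assumes "has_components u X \<xi>"
  shows "has_components (\<lambda>q. - u q) (\<lambda>k q. - X k q) (\<lambda>k q. - \<xi> k q)"
proof -
  have u: "u \<in> sec (gen_tangent_bundle \<A>)" using assms by (simp add: has_components_def)
  \<comment> \<open>\<open>- u = \<J>\<^sup>2 u\<close> is a smooth section because \<open>\<J>\<close> preserves smooth sections.\<close>
  have "(\<lambda>q. - u q) = (\<lambda>q. \<J> q (\<J> q (u q)))" using J_J[OF section_fibre[OF u]] by simp
  then have "(\<lambda>q. - u q) \<in> sec (gen_tangent_bundle \<A>)" using J_section[OF J_section[OF u]] by simp
  then show ?thesis using assms by (simp add: has_components_def)
qed

text \<open>\<open>X l\<close> and \<open>\<xi> l\<close> agree on \<open>V\<close> with smooth
  functions obtained from \<open>u\<close>, and the same holds for their negatives and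
  \<open>- u\<close>. The sign rule is transferred from these smooth representatives.\<close>

lemma partial_minus_components:
  assumes "has_components u X \<xi>" "p \<in> V"
  shows "pd k (\<lambda>q. - X l q) p = - pd k (X l) p" "pd k (\<lambda>q. - \<xi> l q) p = - pd k (\<xi> l) p"
proof -
  have pU: "p \<in> fst (U, x)" using assms V by auto
  have S: "(\<lambda>q. fst (u q)) \<in> vector_fields \<A>" "(\<lambda>q. snd (u q)) \<in> one_forms \<A>"
    using assms by (auto simp: has_components_def gen_section)
  note rules = partial_components[OF assms] partial_components[OF minus_has_components[OF assms(1)] assms(2)]
  show "pd k (\<lambda>q. - X l q) p = - pd k (X l) p"
    using partial_cmult[OF sm vector_field_smooth[OF S(1) g[of l]] chart pU, of k "-1"] rules by simp
  show "pd k (\<lambda>q. - \<xi> l q) p = - pd k (\<xi> l) p"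
    using partial_cmult[OF sm one_form_smooth[OF S(2) E[of l]] chart pU, of k "-1"] rules by simp
qed

text \<open>\<open>Sv\<close> and \<open>Sf\<close> are the vector and covector components of \<open>S = [\<J>u, w] + [u, \<J>w]\<close>.\<close>

lemma integrability_in_components:
  assumes p: "p \<in> V" and u: "has_components u X \<xi>" and w: "has_components w Y \<eta>"
    and u': "has_components (\<lambda>q. \<J> q (u q)) X' \<xi>'" and w': "has_components (\<lambda>q. \<J> q (w q)) Y' \<eta>'"
  defines "Sv \<equiv> \<lambda>k. bracket_vec p X' Y k + bracket_vec p X Y' k"
    and "Sf \<equiv> \<lambda>k. bracket_form p X' \<xi>' Y \<eta> k + bracket_form p X \<xi> Y' \<eta>' k"
  shows "(\<Sum>k\<in>UNIV. Sv k * a k l p + Sf k * b k l p) = bracket_vec p X' Y' l - bracket_vec p X Y l"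
    and "(\<Sum>k\<in>UNIV. Sv k * c k l p + Sf k * d k l p) = bracket_form p X' \<xi>' Y' \<eta>' l - bracket_form p X \<xi> Y \<eta> l"
proof -
  let ?u' = "\<lambda>q. - \<J> q (u q)" and ?w' = "\<lambda>q. - \<J> q (w q)"
  let ?s = "dorfman \<A> u w p - dorfman \<A> ?u' ?w' p" and ?t = "dorfman \<A> u ?w' p + dorfman \<A> ?u' w p"
  note mu' = minus_has_components[OF u'] and mw' = minus_has_components[OF w']
  have "dorfman_complex \<A> (\<lambda>p. minus_i \<J> p (u p)) (\<lambda>p. minus_i \<J> p (w p)) \<in> sec (L10 \<A> \<J>)"
    using integrable u w unfolding integrable_gen_def has_components_def by blast
  then have "dorfman_complex \<A> (\<lambda>p. minus_i \<J> p (u p)) (\<lambda>p. minus_i \<J> p (w p)) p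
      \<in> minus_i \<J> p ` fib (gen_tangent_bundle \<A>) p"
    by (simp add: L10_def Let_def)
  then have "(?s, ?t) \<in> minus_i \<J> p ` fib (gen_tangent_bundle \<A>) p"
    by (simp add: dorfman_complex_def minus_i_def Let_def)
  then have s: "?s \<in> fib (gen_tangent_bundle \<A>) p" and t: "?t = - \<J> p ?s"
    by (auto simp: minus_i_def)
  \<comment> \<open>Since \<J> squares to -1, the vector -\<J>s is the third iterate of \<J> at s,
    which lies in the fibre because \<J> preserves it.\<close>
  have t3: "?t = \<J> p (\<J> p (\<J> p ?s))" unfolding t by (rule J_J[OF J_fibre[OF s], symmetric])
  have t_fib: "?t \<in> fib (gen_tangent_bundle \<A>) p" unfolding t3 by (intro J_fibre s)
  \<comment> \<open>The fourth power of \<J> is the identity. With \<open>?t\<close> equal to -S,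
    this is the equation for \<J>S up to a common sign.\<close>
  have Jt: "\<J> p ?t = ?s"
    using J_J[OF J_fibre[OF J_fibre[OF s]]] J_J[OF s] unfolding t3 by simp
  note neg = partial_minus_components[OF u' p] partial_minus_components[OF w' p]
  \<comment> \<open>Replacing -\<J>u and -\<J>w by \<J>u and \<J>w, the two signs cancel in
    \<open>?s\<close>, while each summand of \<open>?t\<close> keeps one, so \<open>?t\<close> has
    the components of -S.\<close>
  have vec: "fst ?s (g k) = bracket_vec p X Y k - bracket_vec p X' Y' k" "fst ?t (g k) = - Sv k" for k
    unfolding Sv_def
    by (simp_all add: dorfman_components(1)[OF u w p] dorfman_components(1)[OF mu' mw' p]
        dorfman_components(1)[OF u mw' p] dorfman_components(1)[OF mu' w p])
      (simp_all add: bracket_vec_def neg sum_negf sum.distrib sum_subtractf)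
  have form: "snd ?s (E k p) = bracket_form p X \<xi> Y \<eta> k - bracket_form p X' \<xi>' Y' \<eta>' k" "snd ?t (E k p) = - Sf k" for k
    unfolding Sf_def
    by (simp_all add: dorfman_components(2)[OF u w p] dorfman_components(2)[OF mu' mw' p]
        dorfman_components(2)[OF u mw' p] dorfman_components(2)[OF mu' w p])
      (simp_all add: bracket_form_def neg sum_negf sum.distrib sum_subtractf algebra_simps)
  show "(\<Sum>k\<in>UNIV. Sv k * a k l p + Sf k * b k l p) = bracket_vec p X' Y' l - bracket_vec p X Y l"
    using J_components(1)[OF p t_fib, of l] unfolding Jt vec form by (simp add: sum_negf sum.distrib sum_subtractf)
  show "(\<Sum>k\<in>UNIV. Sv k * c k l p + Sf k * d k l p) = bracket_form p X' \<xi>' Y' \<eta>' l - bracket_form p X \<xi> Y \<eta> l"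
    using J_components(2)[OF p t_fib, of l] unfolding Jt vec form by (simp add: sum_negf sum.distrib sum_subtractf)
qed

section \<open>Evaluation on the coordinate frame\<close>

abbreviation "\<delta> \<equiv> \<lambda>i k (q::'m). if k = i then 1 else 0 :: real"
abbreviation "zero \<equiv> \<lambda>(k::'n) (q::'m). 0 :: real"

lemma frame_vec_components: "has_components (\<lambda>q. (E i q, 0)) (\<delta> i) zero"
  unfolding has_components_def gen_section
  by (auto simp: E frame_apply_coord one_forms_def cotangent_space_zero[unfolded func_zero] smooth_functions_const[OF sm]
      func_zero)

lemma frame_form_components: "has_components (\<lambda>q. (0, G i q)) zero (\<delta> i)"
  unfolding has_components_def gen_section
  by (auto simp: G_one_form G_frame vector_fields_def tangent_space_zero[unfolded func_zero] smooth_functions_const[OF sm]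
      func_zero)

lemma J_frame_vec_components: "has_components (\<lambda>q. \<J> q (E i q, 0)) (a i) (c i)"
  using J_has_components[OF frame_vec_components[of i]]
  by (simp add: if_distrib[of "\<lambda>r. r * _"] cong: if_cong)

lemma J_frame_form_components: "has_components (\<lambda>q. \<J> q (0, G i q)) (b i) (d i)"
  using J_has_components[OF frame_form_components[of i]]
  by (simp add: if_distrib[of "\<lambda>r. r * _"] cong: if_cong)

text \<open>Constant coefficients have zero derivative, so only derivatives of the other argument
  survive. The covector formulas are, in order: minus the contraction of d\<xi> with the j-th
  coordinate field, the Lie derivative of \<open>\<eta>\<close> along the i-th one, L_X dx^j =
  d(X^j), and the vanishing of d(dx^i).\<close>

lemma bracket_frame:
  "bracket_vec p X (\<delta> j) k = - pd j (X k) p"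
  "bracket_vec p (\<delta> i) Y k = pd i (Y k) p"
  "bracket_vec p X zero k = 0"
  "bracket_vec p zero Y k = 0"
  "bracket_form p X \<xi> (\<delta> j) zero l = pd l (\<xi> j) p - pd j (\<xi> l) p"
  "bracket_form p (\<delta> i) zero Y \<eta> l = pd i (\<eta> l) p"
  "bracket_form p X \<xi> zero (\<delta> j) l = pd l (X j) p"
  "bracket_form p zero (\<delta> i) Y \<eta> l = 0"
  by (simp_all add: bracket_vec_def bracket_form_def partial_const sum_negf sum.distrib sum_subtractf
      if_distrib[of "\<lambda>r. r * _"] cong: if_cong)

text \<open>Field-field, field-form, form-field and form-form pairs, each giving a vector identity
  followed by a covector identity: the order of the eight equations.\<close>

lemmas integrability_frame =
  integrability_in_components[OF _ frame_vec_components frame_vec_components J_frame_vec_components J_frame_vec_components]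
  integrability_in_components[OF _ frame_vec_components frame_form_components J_frame_vec_components J_frame_form_components]
  integrability_in_components[OF _ frame_form_components frame_vec_components J_frame_form_components J_frame_vec_components]
  integrability_in_components[OF _ frame_form_components frame_form_components J_frame_form_components J_frame_form_components]


lemma frame_equations:
  assumes p: "p \<in> V"
  shows "(\<Sum>k\<in>UNIV. a i k p * pd k (a j l) p - a j k p * pd k (a i l) p
          + a k l p * (pd j (a i k) p - pd i (a j k) p)
          - b k l p * (pd i (c j k) p - pd j (c i k) p + pd k (c i j) p)) = 0" (is ?eq1)
    and "(\<Sum>k\<in>UNIV. a i k p * pd k (c j l) p + c j k p * pd l (a i k) p
          + a j k p * (pd l (c i k) p - pd k (c i l) p)
          + c k l p * (pd j (a i k) p - pd i (a j k) p)
          - d k l p * (pd i (c j k) p - pd j (c i k) p + pd k (c i j) p)) = 0" (is ?eq2)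
    and "(\<Sum>k\<in>UNIV. a i k p * pd k (b j l) p - b j k p * pd k (a i l) p
          - a k l p * pd i (b j k) p
          - b k l p * (pd k (a i j) p + pd i (d j k) p)) = 0" (is ?eq3)
    and "(\<Sum>k\<in>UNIV. a i k p * pd k (d j l) p + d j k p * pd l (a i k) p
          + b j k p * (pd l (c i k) p - pd k (c i l) p)
          - c k l p * pd i (b j k) p
          - d k l p * (pd k (a i j) p + pd i (d j k) p)) = 0" (is ?eq4)
    and "(\<Sum>k\<in>UNIV. b i k p * pd k (a j l) p - a j k p * pd k (b i l) p
          + a k l p * pd j (b i k) p
          + b k l p * (pd j (d i k) p - pd k (d i j) p)) = 0" (is ?eq5)
    and "(\<Sum>k\<in>UNIV. b i k p * pd k (c j l) p + c j k p * pd l (b i k) p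
          + a j k p * (pd l (d i k) p - pd k (d i l) p)
          + c k l p * pd j (b i k) p
          + d k l p * (pd j (d i k) p - pd k (d i j) p)) = 0" (is ?eq6)
    and "(\<Sum>k\<in>UNIV. b i k p * pd k (b j l) p - b j k p * pd k (b i l) p
          - b k l p * pd k (b i j) p) = 0" (is ?eq7)
    and "(\<Sum>k\<in>UNIV. b i k p * pd k (d j l) p + d j k p * pd l (b i k) p
          + b j k p * (pd l (d i k) p - pd k (d i l) p)
          - d k l p * pd k (b i j) p) = 0" (is ?eq8)
proof -
  note rules = bracket_frame partial_const sum.distrib sum_subtractf sum_negf algebra_simps
  \<comment> \<open>Once \<open>bracket_frame\<close> has evaluated every bracket involving a
    coordinate field or form, only the bracket of the two images under \<J> is left to expand; its
    vector argument in first place is \<open>a i\<close> or \<open>b i\<close>.\<close>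
  note defs = bracket_vec_def[of p "a i"] bracket_vec_def[of p "b i"] bracket_form_def[of p "a i"] bracket_form_def[of p "b i"]
  show ?eq1 using integrability_frame(1)[OF p, of i j l] unfolding bracket_frame defs by (simp add: rules)
  show ?eq2 using integrability_frame(2)[OF p, of i j l] unfolding bracket_frame defs by (simp add: rules)
  show ?eq3 using integrability_frame(3)[OF p, of i j l] unfolding bracket_frame defs by (simp add: rules)
  show ?eq4 using integrability_frame(4)[OF p, of i j l] unfolding bracket_frame defs by (simp add: rules)
  show ?eq5 using integrability_frame(5)[OF p, of i j l] unfolding bracket_frame defs by (simp add: rules)
  show ?eq6 using integrability_frame(6)[OF p, of i j l] unfolding bracket_frame defs by (simp add: rules)
  show ?eq7 using integrability_frame(7)[OF p, of i j l] unfolding bracket_frame defs by (simp add: rules)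
  show ?eq8 using integrability_frame(8)[OF p, of i j l] unfolding bracket_frame defs by (simp add: rules)
qed

end

theorem theorem2p8:
  fixes \<A> :: "('m::{t2_space, second_countable_topology}, 'n::finite) chart set"
    and \<J> :: "'m \<Rightarrow> 'm gvec \<Rightarrow> 'm gvec"
    and A :: "'m \<Rightarrow> 'm tvec \<Rightarrow> 'm tvec"
    and B :: "'m \<Rightarrow> 'm covec \<Rightarrow> 'm tvec"
    and C :: "'m \<Rightarrow> 'm tvec \<Rightarrow> 'm covec"
    and D :: "'m \<Rightarrow> 'm covec \<Rightarrow> 'm covec"
    and U :: "'m set" and x :: "'m \<Rightarrow> real ^ 'n"
    and a b c d :: "'n \<Rightarrow> 'n \<Rightarrow> 'm \<Rightarrow> real"
  assumes "smooth_structure \<A>"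
    and "weak_gen_almost_complex \<A> \<J>"
    and "bundle_morphism (tangent_bundle \<A>) (tangent_bundle \<A>) A"
    and "bundle_morphism (cotangent_bundle \<A>) (tangent_bundle \<A>) B"
    and "bundle_morphism (tangent_bundle \<A>) (cotangent_bundle \<A>) C"
    and "bundle_morphism (cotangent_bundle \<A>) (cotangent_bundle \<A>) D"
    and "\<And>p X \<xi>. X \<in> tangent_space \<A> p \<Longrightarrow> \<xi> \<in> cotangent_space \<A> p \<Longrightarrow>
           \<J> p (X, \<xi>) = (A p X + B p \<xi>, C p X + D p \<xi>)"
    and "(U, x) \<in> \<A>"
    and "\<And>p i. p \<in> U \<Longrightarrow>
           A p (coord_vec \<A> (U, x) i p) = (\<Sum>j\<in>UNIV. a i j p *\<^sub>R coord_vec \<A> (U, x) j p)"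
    and "\<And>p i. p \<in> U \<Longrightarrow>
           B p (coord_form \<A> (U, x) i p) = (\<Sum>j\<in>UNIV. b i j p *\<^sub>R coord_vec \<A> (U, x) j p)"
    and "\<And>p i. p \<in> U \<Longrightarrow>
           C p (coord_vec \<A> (U, x) i p) = (\<Sum>j\<in>UNIV. c i j p *\<^sub>R coord_form \<A> (U, x) j p)"
    and "\<And>p i. p \<in> U \<Longrightarrow>
           D p (coord_form \<A> (U, x) i p) = (\<Sum>j\<in>UNIV. d i j p *\<^sub>R coord_form \<A> (U, x) j p)"
    and "integrable_gen \<A> \<J>"
  shows "\<forall>p\<in>U. \<forall>i j l.
       (\<Sum>k\<in>UNIV. a i k p * partial (U, x) k (a j l) p
          - a j k p * partial (U, x) k (a i l) p
          + a k l p * (partial (U, x) j (a i k) p - partial (U, x) i (a j k) p)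
          - b k l p * (partial (U, x) i (c j k) p - partial (U, x) j (c i k) p + partial (U, x) k (c i j) p)) = 0 \<and>
       (\<Sum>k\<in>UNIV. a i k p * partial (U, x) k (c j l) p
          + c j k p * partial (U, x) l (a i k) p
          + a j k p * (partial (U, x) l (c i k) p - partial (U, x) k (c i l) p)
          + c k l p * (partial (U, x) j (a i k) p - partial (U, x) i (a j k) p)
          - d k l p * (partial (U, x) i (c j k) p - partial (U, x) j (c i k) p + partial (U, x) k (c i j) p)) = 0 \<and>
       (\<Sum>k\<in>UNIV. a i k p * partial (U, x) k (b j l) p
          - b j k p * partial (U, x) k (a i l) p
          - a k l p * partial (U, x) i (b j k) p
          - b k l p * (partial (U, x) k (a i j) p + partial (U, x) i (d j k) p)) = 0 \<and>
       (\<Sum>k\<in>UNIV. a i k p * partial (U, x) k (d j l) p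
          + d j k p * partial (U, x) l (a i k) p
          + b j k p * (partial (U, x) l (c i k) p - partial (U, x) k (c i l) p)
          - c k l p * partial (U, x) i (b j k) p
          - d k l p * (partial (U, x) k (a i j) p + partial (U, x) i (d j k) p)) = 0 \<and>
       (\<Sum>k\<in>UNIV. b i k p * partial (U, x) k (a j l) p
          - a j k p * partial (U, x) k (b i l) p
          + a k l p * partial (U, x) j (b i k) p
          + b k l p * (partial (U, x) j (d i k) p - partial (U, x) k (d i j) p)) = 0 \<and>
       (\<Sum>k\<in>UNIV. b i k p * partial (U, x) k (c j l) p
          + c j k p * partial (U, x) l (b i k) p
          + a j k p * (partial (U, x) l (d i k) p - partial (U, x) k (d i l) p)
          + c k l p * partial (U, x) j (b i k) p
          + d k l p * (partial (U, x) j (d i k) p - partial (U, x) k (d i j) p)) = 0 \<and>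
       (\<Sum>k\<in>UNIV. b i k p * partial (U, x) k (b j l) p
          - b j k p * partial (U, x) k (b i l) p
          - b k l p * partial (U, x) k (b i j) p) = 0 \<and>
       (\<Sum>k\<in>UNIV. b i k p * partial (U, x) k (d j l) p
          + d j k p * partial (U, x) l (b i k) p
          + b j k p * (partial (U, x) l (d i k) p - partial (U, x) k (d i l) p)
          - d k l p * partial (U, x) k (b i j) p) = 0"
proof (intro ballI allI)
  fix p i j l assume p: "p \<in> U"
  \<comment> \<open>The frame depends on \<open>p\<close>, which is harmless because the claim is
    pointwise.\<close>
  from local_frame_exists[OF assms(1,8) p] obtain V g E where pV: "p \<in> V" and frame: "local_frame \<A> U x V g E"
    by blast
  interpret local_frame \<A> U x V g E by (rule frame)
  have U: "q \<in> U" if "q \<in> V" for q using that V(2) by blast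
  interpret gen_structure_in_frame \<A> U x V g E \<J> A B C D a b c d
  proof unfold_locales
    fix q k assume q: "q \<in> V"
    show "A q (E k q) = (\<Sum>j\<in>UNIV. a k j q *\<^sub>R E j q)"
      unfolding E_eq[OF q] by (rule assms(9)[OF U[OF q]])
    show "B q (G k q) = (\<Sum>j\<in>UNIV. b k j q *\<^sub>R E j q)"
      unfolding E_eq[OF q] coord_form_eq[OF q, symmetric] by (rule assms(10)[OF U[OF q]])
    show "C q (E k q) = (\<Sum>j\<in>UNIV. c k j q *\<^sub>R G j q)"
      unfolding E_eq[OF q] coord_form_eq[OF q, symmetric] by (rule assms(11)[OF U[OF q]])
    show "D q (G k q) = (\<Sum>j\<in>UNIV. d k j q *\<^sub>R G j q)"
      unfolding coord_form_eq[OF q, symmetric] by (rule assms(12)[OF U[OF q]])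
  qed (rule assms; assumption)+
  show "(\<Sum>k\<in>UNIV. a i k p * partial (U, x) k (a j l) p
          - a j k p * partial (U, x) k (a i l) p
          + a k l p * (partial (U, x) j (a i k) p - partial (U, x) i (a j k) p)
          - b k l p * (partial (U, x) i (c j k) p - partial (U, x) j (c i k) p + partial (U, x) k (c i j) p)) = 0 \<and>
       (\<Sum>k\<in>UNIV. a i k p * partial (U, x) k (c j l) p
          + c j k p * partial (U, x) l (a i k) p
          + a j k p * (partial (U, x) l (c i k) p - partial (U, x) k (c i l) p)
          + c k l p * (partial (U, x) j (a i k) p - partial (U, x) i (a j k) p)
          - d k l p * (partial (U, x) i (c j k) p - partial (U, x) j (c i k) p + partial (U, x) k (c i j) p)) = 0 \<and>
       (\<Sum>k\<in>UNIV. a i k p * partial (U, x) k (b j l) p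
          - b j k p * partial (U, x) k (a i l) p
          - a k l p * partial (U, x) i (b j k) p
          - b k l p * (partial (U, x) k (a i j) p + partial (U, x) i (d j k) p)) = 0 \<and>
       (\<Sum>k\<in>UNIV. a i k p * partial (U, x) k (d j l) p
          + d j k p * partial (U, x) l (a i k) p
          + b j k p * (partial (U, x) l (c i k) p - partial (U, x) k (c i l) p)
          - c k l p * partial (U, x) i (b j k) p
          - d k l p * (partial (U, x) k (a i j) p + partial (U, x) i (d j k) p)) = 0 \<and>
       (\<Sum>k\<in>UNIV. b i k p * partial (U, x) k (a j l) p
          - a j k p * partial (U, x) k (b i l) p
          + a k l p * partial (U, x) j (b i k) p
          + b k l p * (partial (U, x) j (d i k) p - partial (U, x) k (d i j) p)) = 0 \<and>
       (\<Sum>k\<in>UNIV. b i k p * partial (U, x) k (c j l) p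
          + c j k p * partial (U, x) l (b i k) p
          + a j k p * (partial (U, x) l (d i k) p - partial (U, x) k (d i l) p)
          + c k l p * partial (U, x) j (b i k) p
          + d k l p * (partial (U, x) j (d i k) p - partial (U, x) k (d i j) p)) = 0 \<and>
       (\<Sum>k\<in>UNIV. b i k p * partial (U, x) k (b j l) p
          - b j k p * partial (U, x) k (b i l) p
          - b k l p * partial (U, x) k (b i j) p) = 0 \<and>
       (\<Sum>k\<in>UNIV. b i k p * partial (U, x) k (d j l) p
          + d j k p * partial (U, x) l (b i k) p
          + b j k p * (partial (U, x) l (d i k) p - partial (U, x) k (d i l) p)
          - d k l p * partial (U, x) k (b i j) p) = 0"
    by (intro conjI frame_equations[OF pV])
qed

end
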